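(* Let $\mathfrak g$ be the simple Lie algebra of type $D_4$ and let $V^{-14/3}(\mathfrak g)$ be the universal affine vertex algebra of level $k=-\tfrac{14}{3}$. Then there exists a nonzero singular vector $v\in V^{-14/3}(\mathfrak g)$ of $\hat{\mathfrak g}$-weight $-\tfrac{14}{3}\Lambda_0-6\delta+2\omega_1$; that is, $v$ has conformal weight $6$ and $\mathfrak h$-weight $2\omega_1$, and $$e_{\varepsilon_i-\varepsilon_{i+1}}(0)v=0\ (i=1,2,3),\qquad e_{\varepsilon_3+\varepsilon_4}(0)v=0,\qquad f_{\varepsilon_1+\varepsilon_2}(1)v=0 .$$ *)

theory Defs
  imports Complex_Main
begin

type_synonym mat = "nat \<Rightarrow> nat \<Rightarrow> complex"

definition idx :: "nat set" where "idx = {1..8}"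

definition is_mat :: "mat \<Rightarrow> bool" where
  "is_mat A \<longleftrightarrow> (\<forall>i j. (i \<notin> idx \<or> j \<notin> idx) \<longrightarrow> A i j = 0)"

definition mmul :: "mat \<Rightarrow> mat \<Rightarrow> mat" where
  "mmul A B = (\<lambda>i j. \<Sum>l\<in>idx. A i l * B l j)"

definition madd :: "mat \<Rightarrow> mat \<Rightarrow> mat" where
  "madd A B = (\<lambda>i j. A i j + B i j)"

definition msmul :: "complex \<Rightarrow> mat \<Rightarrow> mat" where
  "msmul c A = (\<lambda>i j. c * A i j)"

definition mbr :: "mat \<Rightarrow> mat \<Rightarrow> mat" where
  "mbr X Y = (\<lambda>i j. mmul X Y i j - mmul Y X i j)"

definition Eu :: "nat \<Rightarrow> nat \<Rightarrow> mat" where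
  "Eu p q = (\<lambda>i j. if i = p \<and> j = q then 1 else 0)"

text \<open>so(8) with respect to the symmetric form with antidiagonal Gram matrix J
  (J_{a,9-a} = 1): X^T J + J X = 0, i.e. X_{9-b,a} + X_{9-a,b} = 0.\<close>
definition so8 :: "mat set" where
  "so8 = {X. is_mat X \<and> (\<forall>a\<in>idx. \<forall>b\<in>idx. X (9 - b) a + X (9 - a) b = 0)}"

text \<open>Normalized invariant form (long roots have square length 2): (X|Y) = tr(XY)/2.\<close>
definition nform :: "mat \<Rightarrow> mat \<Rightarrow> complex" where
  "nform X Y = (\<Sum>i\<in>idx. mmul X Y i i) / 2"

text \<open>Letters x(n) = (x, n), words = monomials in the tensor algebra over g \<otimes> C[t,t^-1];
  elements of the tensor algebra are finitely supported functions from words to C.\<close>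
type_synonym letter = "mat \<times> int"
type_synonym word = "letter list"
type_synonym tens = "word \<Rightarrow> complex"

definition gwords :: "mat set \<Rightarrow> word set" where
  "gwords g = {w. \<forall>l\<in>set w. fst l \<in> g}"

definition tadm :: "mat set \<Rightarrow> tens \<Rightarrow> bool" where
  "tadm g f \<longleftrightarrow> finite {w. f w \<noteq> 0} \<and> (\<forall>w. f w \<noteq> 0 \<longrightarrow> w \<in> gwords g)"

definition mono :: "word \<Rightarrow> tens" where
  "mono w = (\<lambda>u. if u = w then 1 else 0)"

definition tadd :: "tens \<Rightarrow> tens \<Rightarrow> tens" where
  "tadd f h = (\<lambda>w. f w + h w)"

definition tsub :: "tens \<Rightarrow> tens \<Rightarrow> tens" where
  "tsub f h = (\<lambda>w. f w - h w)"

definition tsmul :: "complex \<Rightarrow> tens \<Rightarrow> tens" where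
  "tsmul c f = (\<lambda>w. c * f w)"

definition lmul :: "word \<Rightarrow> tens \<Rightarrow> tens" where
  "lmul u f = (\<lambda>w. if take (length u) w = u then f (drop (length u) w) else 0)"

definition rmul :: "tens \<Rightarrow> word \<Rightarrow> tens" where
  "rmul f u = (\<lambda>w. if length u \<le> length w \<and> drop (length w - length u) w = u
                    then f (take (length w - length u) w) else 0)"

text \<open>Defining relations of U(ghat) with K acting by the level k:
  linearity of x \<mapsto> x(n), and
  [x(m), y(n)] = [x,y](m+n) + m \<delta>_{m+n,0} (x|y) k.\<close>
definition affrel :: "mat set \<Rightarrow> (mat \<Rightarrow> mat \<Rightarrow> complex) \<Rightarrow> complex \<Rightarrow> tens set" where
  "affrel g B k =
     {tsub (tsub (mono [(madd (msmul a X) (msmul b Y), n)]) (tsmul a (mono [(X, n)])))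
           (tsmul b (mono [(Y, n)])) | a b X Y n. X \<in> g \<and> Y \<in> g}
   \<union> {tsub (tsub (tsub (mono [(X, m), (Y, n)]) (mono [(Y, n), (X, m)]))
                 (mono [(mbr X Y, m + n)]))
           (tsmul (if m + n = 0 then of_int m * B X Y * k else 0) (mono []))
       | X Y m n. X \<in> g \<and> Y \<in> g}"

text \<open>The kernel of T(ghat) \<rightarrow> V^k(g) = U(ghat) \<otimes>_{U(g[t] + CK)} C_k:
  the two-sided ideal of the defining relations plus the left ideal generated by g[t].\<close>
inductive_set vkker :: "mat set \<Rightarrow> (mat \<Rightarrow> mat \<Rightarrow> complex) \<Rightarrow> complex \<Rightarrow> tens set"
  for g B k where
  zero: "(\<lambda>w. 0) \<in> vkker g B k"
| add: "f \<in> vkker g B k \<Longrightarrow> h \<in> vkker g B k \<Longrightarrow> tadd f h \<in> vkker g B k"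
| smul: "f \<in> vkker g B k \<Longrightarrow> tsmul c f \<in> vkker g B k"
| rel: "r \<in> affrel g B k \<Longrightarrow> u \<in> gwords g \<Longrightarrow> v \<in> gwords g \<Longrightarrow>
         lmul u (rmul r v) \<in> vkker g B k"
| ann: "X \<in> g \<Longrightarrow> n \<ge> 0 \<Longrightarrow> u \<in> gwords g \<Longrightarrow> mono (u @ [(X, n)]) \<in> vkker g B k"

definition vkeq :: "mat set \<Rightarrow> (mat \<Rightarrow> mat \<Rightarrow> complex) \<Rightarrow> complex \<Rightarrow> tens \<Rightarrow> tens \<Rightarrow> bool" where
  "vkeq g B k f h \<longleftrightarrow> tsub f h \<in> vkker g B k"

definition act :: "mat \<Rightarrow> int \<Rightarrow> tens \<Rightarrow> tens" where
  "act X n f = lmul [(X, n)] f"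

text \<open>Degree (= L_0-eigenvalue, conformal weight) of a monomial x1(-n1)...xr(-nr) is n1+...+nr\<close>
definition wdeg :: "word \<Rightarrow> int" where
  "wdeg w = - sum_list (map snd w)"

text \<open>Cartan element H_i = E_ii - E_{9-i,9-i}, dual to epsilon_i (i = 1..4)\<close>
definition Hc :: "nat \<Rightarrow> mat" where
  "Hc i = (\<lambda>a b. Eu i i a b - Eu (9 - i) (9 - i) a b)"

text \<open>root vector for epsilon_i - epsilon_j (i \<noteq> j in 1..4)\<close>
definition e_minus :: "nat \<Rightarrow> nat \<Rightarrow> mat" where
  "e_minus i j = (\<lambda>a b. Eu i j a b - Eu (9 - j) (9 - i) a b)"

text \<open>root vector for epsilon_i + epsilon_j (i < j in 1..4)\<close>
definition e_plus :: "nat \<Rightarrow> nat \<Rightarrow> mat" where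
  "e_plus i j = (\<lambda>a b. Eu i (9 - j) a b - Eu j (9 - i) a b)"

text \<open>root vector for -(epsilon_i + epsilon_j) (i < j in 1..4)\<close>
definition f_plus :: "nat \<Rightarrow> nat \<Rightarrow> mat" where
  "f_plus i j = (\<lambda>a b. Eu (9 - j) i a b - Eu (9 - i) j a b)"

end

theory Submission
  imports Defs "HOL-Library.Function_Algebras"
begin

text \<open>
  Let \<open>J a b = - J b a\<close> be the standard spanning set of so(8), with metric \<open>a + b = 9\<close>.
  The singular vector is a combination of 25 covariant expressions, each the product of a chain
  \<open>J 1 c (-n) J c' d (-m) \<dots> J e' 1 (-p)\<close>, summed over the contracted indices, with
  traces of similar cyclic products. Commuting modes past each other only reconnects such diagrams,
  so applying a mode and normal ordering is a finite rewriting of linear combinations of diagrams.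
  The coefficients span the kernel of the resulting linear system, which is one-dimensional at level
  \<open>-14/3\<close>.

  Nonvanishing does not need the full PBW theorem. Negative modes act by \<open>8 \<times> 8\<close> matrices
  on graded column vectors; coinducing this action, that is, letting a nonnegative mode act on the
  word to its right as a derivation with central term, gives a linear functional that kills the
  kernel of the projection to the vacuum module and is nonzero on the singular vector.
\<close>

section \<open>The tensor algebra modulo the kernel\<close>

text \<open>Expanded into monomials, one covariant expression has up to 8^5 terms, so every
  computation keeps the index sums symbolic and the arithmetic left over is with integers. Of the
  rewriting only soundness is proved: each step preserves the class modulo the kernel. That it ends
  in zero is seen by running it inside the logic, once for each mode in question. Such a calculus
  proves equalities but cannot show that a vector is nonzero, since distinct irreducible diagrams
  might still be congruent; this is why a functional is constructed separately. It is defined on all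
  words, not on normally ordered ones, so that only compatibility with the relations has to be
  checked. The vector representation suits it because its first and last basis vectors have weights
  epsilon_1 and -epsilon_1: the matrix entry between them has weight 2 epsilon_1 = 2 omega_1, the
  weight sought. For the same reason both free ends of a chain carry the index 1.\<close>

lemmas pointwise = plus_fun_apply zero_fun_apply minus_apply uminus_apply

declare pointwise [simp del]

lemma tadd_eq: "tadd f h = f + h" and tsub_eq: "tsub f h = f - h"
  by (simp_all add: tadd_def tsub_def fun_eq_iff pointwise)

lemma tsmul_simps [simp]:
  "tsmul c (f + h) = tsmul c f + tsmul c h" "tsmul c (f - h) = tsmul c f - tsmul c h"
  "tsmul (c + d) f = tsmul c f + tsmul d f" "tsmul (c - d) f = tsmul c f - tsmul d f"
  "tsmul c (tsmul d f) = tsmul (c * d) f" "tsmul 0 f = 0" "tsmul c 0 = 0" "tsmul 1 f = f"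
  "tsmul (- c) f = - tsmul c f" "tsmul c (- f) = - tsmul c f"
  by (simp_all add: tsmul_def fun_eq_iff pointwise algebra_simps)

lemma tsmul_sum: "tsmul c (\<Sum>x\<in>S. f x) = (\<Sum>x\<in>S. tsmul c (f x))"
  by (induction S rule: infinite_finite_induct) (simp_all only: sum.infinite sum.empty sum.insert
      tsmul_simps not_False_eq_True)

lemma lmul_linear [simp]:
  "lmul u (f + h) = lmul u f + lmul u h" "lmul u (f - h) = lmul u f - lmul u h"
  "lmul u (tsmul c f) = tsmul c (lmul u f)" "lmul u 0 = 0"
  by (simp_all add: lmul_def tsmul_def fun_eq_iff pointwise)

lemma lmul_sum: "lmul u (\<Sum>x\<in>S. f x) = (\<Sum>x\<in>S. lmul u (f x))"
  by (induction S rule: infinite_finite_induct) (simp_all only: sum.infinite sum.empty sum.insert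
      lmul_linear not_False_eq_True)

lemma rmul_linear [simp]:
  "rmul (f + h) u = rmul f u + rmul h u" "rmul (f - h) u = rmul f u - rmul h u"
  "rmul (tsmul c f) u = tsmul c (rmul f u)"
  by (simp_all add: rmul_def tsmul_def fun_eq_iff pointwise)

lemma lmul_mono [simp]: "lmul u (mono w) = mono (u @ w)"
  by (auto simp: lmul_def mono_def fun_eq_iff) (metis append_take_drop_id)

lemma rmul_mono [simp]: "rmul (mono w) v = mono (w @ v)"
  by (auto simp: rmul_def mono_def fun_eq_iff) (metis append_take_drop_id)+

lemma gwords_simps [simp]:
  "[] \<in> gwords g" "l # w \<in> gwords g \<longleftrightarrow> fst l \<in> g \<and> w \<in> gwords g"
  "u @ v \<in> gwords g \<longleftrightarrow> u \<in> gwords g \<and> v \<in> gwords g"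
  by (auto simp: gwords_def)

context
  fixes g :: "mat set" and B :: "mat \<Rightarrow> mat \<Rightarrow> complex" and k :: complex
begin

abbreviation (input) keq (infix "\<approx>" 50) where "f \<approx> h \<equiv> vkeq g B k f h"

lemma keq_iff: "f \<approx> h \<longleftrightarrow> f - h \<in> vkker g B k"
  by (simp add: vkeq_def tsub_eq)

lemma vkker_0: "0 \<in> vkker g B k"
  using vkker.zero by (simp add: zero_fun_def)

lemma vkker_add: "f \<in> vkker g B k \<Longrightarrow> h \<in> vkker g B k \<Longrightarrow> f + h \<in> vkker g B k"
  using vkker.add by (simp add: tadd_eq)

lemma vkker_uminus: "f \<in> vkker g B k \<Longrightarrow> - f \<in> vkker g B k"
  using vkker.smul[of f g B k "-1"] by simp

lemma keq_refl [simp]: "f \<approx> f"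
  by (simp add: keq_iff vkker_0)

lemma keq_sym: "f \<approx> h \<Longrightarrow> h \<approx> f"
  using vkker_uminus[of "f - h"] by (simp add: keq_iff)

lemma keq_trans [trans]: "f \<approx> h \<Longrightarrow> h \<approx> e \<Longrightarrow> f \<approx> e"
  using vkker_add[of "f - h" "h - e"] by (simp add: keq_iff)

lemma keq_add: "f \<approx> h \<Longrightarrow> f' \<approx> h' \<Longrightarrow> f + f' \<approx> h + h'"
  using vkker_add[of "f - h" "f' - h'"] by (simp add: keq_iff algebra_simps)

lemma keq_smul: "f \<approx> h \<Longrightarrow> tsmul c f \<approx> tsmul c h"
  using vkker.smul[of "f - h"] by (simp add: keq_iff)

lemma keq_uminus: "f \<approx> h \<Longrightarrow> - f \<approx> - h"
  using keq_smul[of f h "-1"] by simp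

lemma keq_diff: "f \<approx> h \<Longrightarrow> f' \<approx> h' \<Longrightarrow> f - f' \<approx> h - h'"
  using keq_add[OF _ keq_uminus, of f h f' h'] by simp

lemma keq_sum: "(\<And>x. x \<in> S \<Longrightarrow> f x \<approx> h x) \<Longrightarrow> (\<Sum>x\<in>S. f x) \<approx> (\<Sum>x\<in>S. h x)"
  by (induction S rule: infinite_finite_induct) (auto intro: keq_add)

lemma keq_linear:
  assumes "X \<in> g" "Y \<in> g" "u \<in> gwords g" "v \<in> gwords g"
  shows "mono (u @ (madd (msmul a X) (msmul b Y), n) # v) \<approx>
    tsmul a (mono (u @ (X, n) # v)) + tsmul b (mono (u @ (Y, n) # v))"
proof -
  let ?r = "tsub (tsub (mono [(madd (msmul a X) (msmul b Y), n)]) (tsmul a (mono [(X, n)])))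
    (tsmul b (mono [(Y, n)]))"
  have "?r \<in> affrel g B k"
    unfolding affrel_def
    by (rule UnI1, rule CollectI, intro exI, rule conjI, rule refl) (use assms in simp)
  from vkker.rel[OF this assms(3,4)] show ?thesis
    by (simp add: keq_iff tsub_eq diff_diff_eq)
qed

lemma keq_swap:
  assumes "X \<in> g" "Y \<in> g" "u \<in> gwords g" "v \<in> gwords g"
  shows "mono (u @ (X, m) # (Y, n) # v) - mono (u @ (Y, n) # (X, m) # v) \<approx>
    mono (u @ (mbr X Y, m + n) # v)
      + tsmul (if m + n = 0 then of_int m * B X Y * k else 0) (mono (u @ v))"
proof -
  let ?r = "tsub (tsub (tsub (mono [(X, m), (Y, n)]) (mono [(Y, n), (X, m)]))
    (mono [(mbr X Y, m + n)])) (tsmul (if m + n = 0 then of_int m * B X Y * k else 0) (mono []))"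
  have "?r \<in> affrel g B k"
    unfolding affrel_def
    by (rule UnI2, rule CollectI, intro exI, rule conjI, rule refl) (use assms in simp)
  from vkker.rel[OF this assms(3,4)] show ?thesis
    by (simp add: keq_iff tsub_eq diff_diff_eq add.assoc split del: if_split)
qed

lemma keq_vacuum: "X \<in> g \<Longrightarrow> n \<ge> 0 \<Longrightarrow> u \<in> gwords g \<Longrightarrow> mono (u @ [(X, n)]) \<approx> 0"
  using vkker.ann by (simp add: keq_iff)

end

section \<open>The matrices J a b, their brackets and their inner products\<close>

definition metric :: "nat \<Rightarrow> nat \<Rightarrow> complex" where
  "metric a b = (if a + b = 9 then 1 else 0)"

text \<open>This is the wedge of the basis vectors a and b, acting by x \<mapsto> e_a (e_b|x) - e_b
  (e_a|x). All Cartan elements and root vectors of the statement have this form without extra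
  signs.\<close>

definition Jm :: "nat \<Rightarrow> nat \<Rightarrow> mat" where
  "Jm a b = (\<lambda>i j. Eu a (9 - b) i j - Eu b (9 - a) i j)"

lemma e_plus_eq: "e_plus i j = Jm i j"
  by (simp add: e_plus_def Jm_def)

lemma f_plus_eq: "i \<in> idx \<Longrightarrow> j \<in> idx \<Longrightarrow> f_plus i j = Jm (9 - j) (9 - i)"
  by (auto simp: f_plus_def Jm_def idx_def)

lemma e_minus_eq: "j \<in> idx \<Longrightarrow> e_minus i j = Jm i (9 - j)"
  by (auto simp: e_minus_def Jm_def idx_def)

lemma Hc_eq: "i \<in> idx \<Longrightarrow> Hc i = Jm i (9 - i)"
  by (auto simp: Hc_def Jm_def idx_def)

lemma dual_idx [simp]: "p \<in> idx \<Longrightarrow> 9 - p \<in> idx"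
  by (auto simp: idx_def)

lemma Jm_so8:
  assumes "p \<in> idx" "q \<in> idx"
  shows "Jm p q \<in> so8"
proof -
  have dual: "9 - b = r \<longleftrightarrow> b = 9 - r" if "r \<in> idx" "b \<in> idx" for r b :: nat
    using that unfolding idx_def by simp presburger
  have entry: "Jm p q (9 - b) a =
      of_bool (b = 9 - p \<and> a = 9 - q) - of_bool (b = 9 - q \<and> a = 9 - p)"
    if "b \<in> idx" for a b
    unfolding Jm_def Eu_def dual[OF assms(1) that] dual[OF assms(2) that] by (simp only:
        of_bool_def)
  have cancel: "of_bool (P \<and> Q) - of_bool (R \<and> S) + (of_bool (S \<and> R) - of_bool (Q \<and> P)) = (0 ::
      complex)"
    for P Q R S
    by (cases P; cases Q; cases R; cases S) simp_all
  have "Jm p q (9 - b) a + Jm p q (9 - a) b = 0" if "a \<in> idx" "b \<in> idx" for a b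
    unfolding entry[OF that(1)] entry[OF that(2)] by (rule cancel)
  moreover have "is_mat (Jm p q)"
    unfolding is_mat_def Jm_def Eu_def using assms dual_idx[OF assms(1)] dual_idx[OF assms(2)]
    by auto
  ultimately show ?thesis
    unfolding so8_def by blast
qed

lemma so8_lincomb:
  assumes "X \<in> so8" "Y \<in> so8"
  shows "madd (msmul a X) (msmul b Y) \<in> so8"
proof -
  have "a * X (9 - j) i + b * Y (9 - j) i + (a * X (9 - i) j + b * Y (9 - i) j)
    = a * (X (9 - j) i + X (9 - i) j) + b * (Y (9 - j) i + Y (9 - i) j)" for i j
    by (simp add: algebra_simps)
  then show ?thesis
    using assms by (simp add: so8_def is_mat_def madd_def msmul_def)
qed

lemma mmul_Eu_diff:
  assumes "q \<in> idx" "s \<in> idx"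
  shows "mmul (\<lambda>i j. Eu p q i j - Eu r s i j) (\<lambda>i j. Eu t u i j - Eu v w i j) i j =
    of_bool (q = t) * Eu p u i j - of_bool (q = v) * Eu p w i j
    - of_bool (s = t) * Eu r u i j + of_bool (s = v) * Eu r w i j"
proof -
  have prod: "(\<Sum>l\<in>idx. Eu p q i l * Eu t u l j) = of_bool (q = t) * Eu p u i j"
    if "q \<in> idx" for p q t u
  proof -
    have "(\<Sum>l\<in>idx. Eu p q i l * Eu t u l j) =
        (\<Sum>l\<in>idx. if l = q then of_bool (q = t) * Eu p u i j else 0)"
      by (intro sum.cong) (auto simp: Eu_def)
    with that show ?thesis by (simp add: idx_def)
  qed
  show ?thesis
    by (simp add: mmul_def left_diff_distrib right_diff_distrib sum_subtractf prod assms)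
qed

lemma metric_dual: "a \<in> idx \<Longrightarrow> metric a b = of_bool (9 - a = b)"
  by (auto simp: metric_def idx_def)

lemma metric_commute: "metric a b = metric b a"
  by (simp add: metric_def add.commute)

lemma mmul_Jm:
  assumes "a \<in> idx" "b \<in> idx"
  shows "mmul (Jm a b) (Jm c d) i j =
    metric b c * Eu a (9 - d) i j - metric b d * Eu a (9 - c) i j
    - metric a c * Eu b (9 - d) i j + metric a d * Eu b (9 - c) i j"
  unfolding Jm_def metric_dual[OF assms(1)] metric_dual[OF assms(2)]
  by (rule mmul_Eu_diff) (simp_all add: assms)

text \<open>The four terms are nested in pairs, with outer coefficients 1, because a defining
  relation expands a combination of two matrices only; three applications of it expand this
  bracket.\<close>

lemma mbr_Jm:
  assumes "a \<in> idx" "b \<in> idx" "c \<in> idx" "d \<in> idx"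
  shows "mbr (Jm a b) (Jm c d) =
    madd (msmul 1 (madd (msmul (metric b c) (Jm a d)) (msmul (- metric a c) (Jm b d))))
      (msmul 1 (madd (msmul (- metric b d) (Jm a c)) (msmul (metric a d) (Jm b c))))"
proof (intro ext)
  fix i j
  show "mbr (Jm a b) (Jm c d) i j =
    madd (msmul 1 (madd (msmul (metric b c) (Jm a d)) (msmul (- metric a c) (Jm b d))))
      (msmul 1 (madd (msmul (- metric b d) (Jm a c)) (msmul (metric a d) (Jm b c)))) i j"
    unfolding mbr_def mmul_Jm[OF assms(1,2)] mmul_Jm[OF assms(3,4)]
      metric_commute[of c a] metric_commute[of c b] metric_commute[of d a] metric_commute[of d b]
    by (simp only: madd_def msmul_def Jm_def algebra_simps mult_1_left) algebra
qed

lemma nform_Jm: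
  assumes "a \<in> idx" "b \<in> idx" "c \<in> idx" "d \<in> idx"
  shows "nform (Jm a b) (Jm c d) = metric b c * metric a d - metric a c * metric b d"
proof -
  have trace: "(\<Sum>i\<in>idx. c * Eu p (9 - q) i i) = c * metric q p" if "p \<in> idx" "q \<in> idx" for p q c
  proof -
    have "(\<Sum>i\<in>idx. c * Eu p (9 - q) i i) = (\<Sum>i\<in>idx. if i = p then c * of_bool (9 - q = p) else 0)"
      by (intro sum.cong) (auto simp only: Eu_def of_bool_def mult_1_right mult_zero_right split:
          if_splits)
    then show ?thesis using that by (simp add: idx_def metric_dual)
  qed
  show ?thesis
    unfolding nform_def mmul_Jm[OF assms(1,2)] sum.distrib sum_subtractf
    by (simp add: trace assms metric_commute[of d b] metric_commute[of c b] metric_commute[of d a]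
        metric_commute[of c a])
qed

section \<open>A functional on the vacuum module\<close>

lemma mmul_assoc: "mmul (mmul X Y) Z = mmul X (mmul Y Z)"
  by (auto simp: mmul_def fun_eq_iff sum_distrib_left sum_distrib_right mult.assoc intro: sum.swap)

lemma mmul_mbr:
  "mmul (mbr X Y) Z i j = mmul X (mmul Y Z) i j - mmul Y (mmul X Z) i j"
  "mmul Z (mbr X Y) i j = mmul Z (mmul X Y) i j - mmul Z (mmul Y X) i j"
  unfolding mmul_assoc[of X, symmetric] mmul_assoc[of Y, symmetric]
    mmul_def[of "mbr X Y"] mmul_def[of "mmul X Y"] mmul_def[of "mmul Y X"] mmul_def[of Z]
  by (simp_all add: mbr_def left_diff_distrib right_diff_distrib sum_subtractf)

lemma mbr_lincomb:
  "mbr (madd (msmul a X) (msmul b Y)) Z = madd (msmul a (mbr X Z)) (msmul b (mbr Y Z))"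
  "mbr Z (madd (msmul a X) (msmul b Y)) = madd (msmul a (mbr Z X)) (msmul b (mbr Z Y))"
  by (simp_all add: fun_eq_iff mbr_def mmul_def madd_def msmul_def algebra_simps sum.distrib
      sum_distrib_left)

text \<open>Even a change of sign is written as a combination of two matrices, here with second
  coefficient 0, so that linearity of letters applies to it. The Jacobi identities below have the
  same shape.\<close>

lemma mbr_antisym: "mbr Y X = madd (msmul (- 1) (mbr X Y)) (msmul 0 (mbr X Y))"
  by (simp add: fun_eq_iff mbr_def madd_def msmul_def)

lemma mbr_jacobi:
  "madd (msmul 1 (mbr (mbr Z X) Y)) (msmul 1 (mbr X (mbr Z Y))) = mbr Z (mbr X Y)"
  "madd (msmul 1 (mbr Y (mbr X Z))) (msmul (- 1) (mbr X (mbr Y Z))) = mbr (mbr Y X) Z"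
  unfolding fun_eq_iff mbr_def[of "mbr _ _"] mbr_def[of _ "mbr _ _"] mmul_mbr madd_def msmul_def
  by (simp_all add: mmul_assoc)

lemma trace_mmul: "(\<Sum>i\<in>idx. mmul X Y i i) = (\<Sum>i\<in>idx. mmul Y X i i)"
  unfolding mmul_def by (subst sum.swap) (simp add: mult.commute)

lemma nform_commute: "nform X Y = nform Y X"
  by (simp add: nform_def trace_mmul)

lemma nform_mbr: "nform (mbr X Y) Z = nform X (mbr Y Z)"
proof -
  have "(\<Sum>i\<in>idx. mmul Y (mmul X Z) i i) = (\<Sum>i\<in>idx. mmul X (mmul Z Y) i i)"
    by (simp only: trace_mmul[of Y] mmul_assoc)
  then show ?thesis
    by (simp add: nform_def mmul_mbr sum_subtractf)
qed

lemma nform_lincomb: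
  "nform (madd (msmul a X) (msmul b Y)) Z = a * nform X Z + b * nform Y Z"
  "nform Z (madd (msmul a X) (msmul b Y)) = a * nform Z X + b * nform Z Y"
  by (simp_all add: nform_def mmul_def madd_def msmul_def algebra_simps sum.distrib sum_distrib_left
      add_divide_distrib sum_divide_distrib)

section \<open>Central cocycle and commutation of a mode with a word\<close>

context fixes k :: complex begin

definition cocycle :: "mat \<Rightarrow> int \<Rightarrow> mat \<Rightarrow> int \<Rightarrow> complex" where
  "cocycle X m Y n = (if m + n = 0 then of_int m * nform X Y * k else 0)"

lemma cocycle_lincomb:
  "cocycle (madd (msmul a X) (msmul b Y)) m Z n = a * cocycle X m Z n + b * cocycle Y m Z n"
  "cocycle Z n (madd (msmul a X) (msmul b Y)) m = a * cocycle Z n X m + b * cocycle Z n Y m"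
  by (simp_all add: cocycle_def nform_lincomb algebra_simps)

lemma cocycle_antisym: "cocycle Y n X m = - cocycle X m Y n"
  using nform_commute[of X Y] by (auto simp: cocycle_def add_eq_0_iff)

lemma nform_mbr': "nform X (mbr Z Y) = - nform Z (mbr X Y)"
proof -
  have "nform X (mbr Z Y) = nform (mbr X Z) Y" by (simp add: nform_mbr)
  also have "\<dots> = - nform (mbr Z X) Y"
    unfolding mbr_antisym[of X Z] nform_lincomb by simp
  finally show ?thesis by (simp add: nform_mbr)
qed

text \<open>The 2-cocycle identity, in the two arrangements needed for relations inside a word and
  for two successive derivations. By invariance all inner products agree up to sign, and the mode
  factors match as in (p + m) - m = p.\<close>

lemma cocycle_cocycle:
  "cocycle (mbr Z X) (p + m) Y n + cocycle X m (mbr Z Y) (p + n) = cocycle Z p (mbr X Y) (m + n)"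
  "cocycle Y n (mbr X Z) (m + p) - cocycle X m (mbr Y Z) (n + p) = cocycle (mbr Y X) (n + m) Z p"
  unfolding cocycle_def nform_mbr nform_mbr'[of X Z Y] nform_mbr'[of X Y Z]
  by (simp_all add: algebra_simps)

text \<open>\<open>der X m F w\<close> is \<open>F\<close> applied to the commutator of \<open>X(m)\<close> with \<open>w\<close>,
  where the central element acts by \<open>k\<close>.\<close>

fun der :: "mat \<Rightarrow> int \<Rightarrow> (word \<Rightarrow> complex) \<Rightarrow> word \<Rightarrow> complex" where
  "der X m F [] = 0"
| "der X m F ((Y, n) # w) =
    F ((mbr X Y, m + n) # w) + cocycle X m Y n * F w + der X m (\<lambda>v. F ((Y, n) # v)) w"

text \<open>\<open>phi\<close> passes itself to \<open>der\<close> as the argument \<open>F\<close>.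
  This congruence tells the function package that \<open>F\<close> is called only on words no longer
  than \<open>w\<close>, which gives termination.\<close>

lemma der_cong [fundef_cong]:
  "w = w' \<Longrightarrow> (\<And>v. length v \<le> length w' \<Longrightarrow> F v = F' v) \<Longrightarrow> der X m F w = der X m F' w'"
  by (induction X m F w arbitrary: w' F' rule: der.induct) auto

lemma der_add: "der X m (\<lambda>v. F v + G v) w = der X m F w + der X m G w"
  by (induction w arbitrary: F G) (auto simp: algebra_simps)

lemma der_cmult: "der X m (\<lambda>v. c * F v) w = c * der X m F w"
  by (induction w arbitrary: F) (auto simp: algebra_simps)

lemma der_multc: "der X m (\<lambda>v. F v * c) w = der X m F w * c"
  using der_cmult[of X m c F w] by (simp only: mult.commute)

lemma der_0: "der X m (\<lambda>v. 0) w = 0"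
  using der_cmult[of X m 0 "\<lambda>v. 0" w] by simp

lemma der_diff: "der X m (\<lambda>v. F v - G v) w = der X m F w - der X m G w"
  using der_add[of X m F "\<lambda>v. - 1 * G v" w] unfolding der_cmult by simp

lemma der_sum: "der X m (\<lambda>v. \<Sum>l\<in>S. c l * F l v) w = (\<Sum>l\<in>S. c l * der X m (F l) w)"
  by (induction S rule: infinite_finite_induct) (simp_all add: der_0 der_add der_cmult)

lemma der_append: "der X m F (u @ v) = der X m (\<lambda>u. F (u @ v)) u + der X m (\<lambda>v. F (u @ v)) v"
  by (induction u arbitrary: F) auto

text \<open>The bound \<open>N\<close> is the greatest length of the words involved: values of
  \<open>phi\<close> on words of length N + 1 are built from those on shorter words, so
  compatibility is an induction on \<open>N\<close>. Letters range over all matrices, hence brackets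
  stay in range.\<close>

definition respects_linearity :: "nat \<Rightarrow> (word \<Rightarrow> complex) \<Rightarrow> bool" where
  "respects_linearity N F \<longleftrightarrow> (\<forall>u v a b X Y n. length u + length v < N \<longrightarrow>
    F (u @ (madd (msmul a X) (msmul b Y), n) # v) = a * F (u @ (X, n) # v) + b * F (u @ (Y, n) #
        v))"

definition respects_commutation :: "nat \<Rightarrow> (word \<Rightarrow> complex) \<Rightarrow> bool" where
  "respects_commutation N F \<longleftrightarrow> (\<forall>u v X Y m n. length u + length v + 1 < N \<longrightarrow>
    F (u @ (X, m) # (Y, n) # v) - F (u @ (Y, n) # (X, m) # v)
      - F (u @ (mbr X Y, m + n) # v) - cocycle X m Y n * F (u @ v) = 0)"

lemma linD: "respects_linearity N F \<Longrightarrow> length u + length v < N \<Longrightarrow>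
    F (u @ (madd (msmul a X) (msmul b Y), n) # v) = a * F (u @ (X, n) # v) + b * F (u @ (Y, n) # v)"
  by (simp add: respects_linearity_def)

lemma cmmD: "respects_commutation N F \<Longrightarrow> length u + length v + 1 < N \<Longrightarrow>
    F (u @ (X, m) # (Y, n) # v) - F (u @ (Y, n) # (X, m) # v)
      - F (u @ (mbr X Y, m + n) # v) - cocycle X m Y n * F (u @ v) = 0"
  by (simp add: respects_commutation_def)

lemma respects_linearity_Cons: "respects_linearity N F \<Longrightarrow> respects_linearity (N - 1) (\<lambda>v. F (l # v))"
  unfolding respects_linearity_def by (metis append_Cons length_Cons less_diff_conv add_Suc
      Suc_eq_plus1)

lemma der_lin_letter:
  "respects_linearity N F \<Longrightarrow> length w \<le> N \<Longrightarrow>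
    der (madd (msmul a X) (msmul b Y)) m F w = a * der X m F w + b * der Y m F w"
proof (induction w arbitrary: N F)
  case (Cons l w)
  obtain Z n where l: "l = (Z, n)" by (cases l)
  show ?case
    using linD[OF Cons.prems(1), of "[]" w a "mbr X Z" b "mbr Y Z" "m + n"] Cons.prems(2)
      Cons.IH[OF respects_linearity_Cons[OF Cons.prems(1), of l]]
    by (simp add: l mbr_lincomb cocycle_lincomb algebra_simps)
qed simp

lemma der_respects_linearity:
  assumes "respects_linearity N F" shows "respects_linearity N (der Z p F)"
  unfolding respects_linearity_def
proof (intro allI impI)
  fix u v :: word and a b X Y n
  assume size_of: "length u + length v < N"
  let ?XY = "madd (msmul a X) (msmul b Y)"
  have 1: "der Z p (\<lambda>u. F (u @ (?XY, n) # v)) u =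
      der Z p (\<lambda>u. a * F (u @ (X, n) # v) + b * F (u @ (Y, n) # v)) u"
    using size_of by (intro der_cong refl linD[OF assms]) auto
  have 2: "der Z p (\<lambda>v. F (u @ (?XY, n) # v)) v =
      der Z p (\<lambda>v. a * F (u @ (X, n) # v) + b * F (u @ (Y, n) # v)) v"
    using size_of by (intro der_cong refl linD[OF assms]) auto
  show "der Z p F (u @ (?XY, n) # v) = a * der Z p F (u @ (X, n) # v) + b * der Z p F (u @ (Y, n) #
      v)"
    using linD[OF assms size_of, of a "mbr Z X" b "mbr Z Y" "p + n"] 1 2
    by (simp add: der_append mbr_lincomb cocycle_lincomb der_add der_cmult algebra_simps)
qed

text \<open>A derivation maps a commutation relation to a combination of such relations. Acting on
  the surroundings gives 1 and 2, acting on one of the two letters gives two further instances of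
  the relation; the bracket and central terms then match by the Jacobi identity (3) and the cocycle
  identity (4).\<close>

lemma der_respects_commutation:
  assumes "respects_linearity N F" "respects_commutation N F" shows "respects_commutation N (der Z p
      F)"
  unfolding respects_commutation_def
proof (intro allI impI)
  fix u v :: word and X Y m n
  assume size_of: "length u + length v + 1 < N"
  have 1: "der Z p (\<lambda>u. F (u @ (X, m) # (Y, n) # v) - F (u @ (Y, n) # (X, m) # v)
      - F (u @ (mbr X Y, m + n) # v) - cocycle X m Y n * F (u @ v)) u = 0"
    using size_of by (subst der_0[symmetric, of Z p u], intro der_cong refl cmmD[OF assms(2)]) auto
  have 2: "der Z p (\<lambda>v. F (u @ (X, m) # (Y, n) # v) - F (u @ (Y, n) # (X, m) # v)
      - F (u @ (mbr X Y, m + n) # v) - cocycle X m Y n * F (u @ v)) v = 0"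
    using size_of by (subst der_0[symmetric, of Z p v], intro der_cong refl cmmD[OF assms(2)]) auto
  have 3: "F (u @ (mbr Z (mbr X Y), p + (m + n)) # v) =
      F (u @ (mbr (mbr Z X) Y, p + m + n) # v) + F (u @ (mbr X (mbr Z Y), m + (p + n)) # v)"
    using linD[OF assms(1), of u v 1 "mbr (mbr Z X) Y" 1 "mbr X (mbr Z Y)" "p + (m + n)"] size_of
    by (simp only: mbr_jacobi) (simp add: algebra_simps)
  have 4: "cocycle Z p (mbr X Y) (m + n) * F (u @ v) =
      cocycle (mbr Z X) (p + m) Y n * F (u @ v) + cocycle X m (mbr Z Y) (p + n) * F (u @ v)"
    unfolding cocycle_cocycle(1)[of Z X p m Y n, symmetric] by (simp only: distrib_right)
  show "der Z p F (u @ (X, m) # (Y, n) # v) - der Z p F (u @ (Y, n) # (X, m) # v)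
      - der Z p F (u @ (mbr X Y, m + n) # v) - cocycle X m Y n * der Z p F (u @ v) = 0"
    using cmmD[OF assms(2) size_of, of "mbr Z X" "p + m" Y n] cmmD[OF assms(2) size_of, of X m "mbr
        Z Y" "p + n"]
      1[simplified der_diff der_cmult] 2[simplified der_diff der_cmult] 3 4
    by (simp add: der_append algebra_simps)
qed

text \<open>Derivations act on functionals by transposition, which reverses their order; hence the
  bracket of \<open>Y\<close> with \<open>X\<close>. A central element commutes with every word, so
  there is no central term.\<close>

lemma der_der:
  "respects_linearity N F \<Longrightarrow> length w \<le> N \<Longrightarrow>
    der X m (der Y n F) w - der Y n (der X m F) w = der (mbr Y X) (n + m) F w"
proof (induction w arbitrary: N F)
  case (Cons l w)
  obtain Z p where l: "l = (Z, p)" by (cases l)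
  have 1: "F ((mbr (mbr Y X) Z, n + m + p) # w) =
      F ((mbr Y (mbr X Z), n + (m + p)) # w) - F ((mbr X (mbr Y Z), m + (n + p)) # w)"
    using linD[OF Cons.prems(1), of "[]" w 1 "mbr Y (mbr X Z)" "- 1" "mbr X (mbr Y Z)" "n + m + p"]
      Cons.prems(2)
    by (simp only: mbr_jacobi) (simp add: algebra_simps)
  have 2: "cocycle (mbr Y X) (n + m) Z p * F w =
      cocycle Y n (mbr X Z) (m + p) * F w - cocycle X m (mbr Y Z) (n + p) * F w"
    unfolding cocycle_cocycle(2)[of Y n X Z m p, symmetric] by (simp only: left_diff_distrib)
  show ?case
    using Cons.IH[OF respects_linearity_Cons[OF Cons.prems(1), of l]] Cons.prems(2) 1 2
    by (simp add: l der_add der_cmult der_multc algebra_simps)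
qed simp

text \<open>\<open>phi w n i\<close> is the \<open>i\<close>-th entry of the degree \<open>n\<close> part of \<open>w\<close> applied to the
  last basis vector.\<close>

function phi :: "word \<Rightarrow> int \<Rightarrow> nat \<Rightarrow> complex" where
  "phi [] n i = (if n = 0 \<and> i = 8 then 1 else 0)"
| "phi ((X, m) # w) n i =
    (if m < 0 then \<Sum>l\<in>idx. X i l * phi w (n + m) l else der X m (\<lambda>v. phi v n i) w)"
  by pat_completeness auto
termination by (relation "measure (\<lambda>(w, n, i). length w)") auto

text \<open>At the head of a word the signs of the modes decide. Two negative modes multiply as
  matrices; for a nonnegative mode before a negative one the relation is the recursion itself; two
  nonnegative modes are covered by \<open>der_der\<close>. Behind a first letter the relation is
  inherited through the matrix or the derivation.\<close>

lemma phi_lin_respects_commutation: "respects_linearity N (\<lambda>w. phi w n i) \<and> respects_commutation N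
    (\<lambda>w. phi w n i)"
proof (induction N arbitrary: n i)
  case 0
  show ?case by (simp add: respects_linearity_def respects_commutation_def)
next
  case (Suc N)
  have respects_linearity: "respects_linearity (Suc N) (\<lambda>w. phi w n i)" for n i
    unfolding respects_linearity_def
  proof (intro allI impI)
    fix u v :: word and a b X Y m
    assume size_of: "length u + length v < Suc N"
    show "phi (u @ (madd (msmul a X) (msmul b Y), m) # v) n i =
      a * phi (u @ (X, m) # v) n i + b * phi (u @ (Y, m) # v) n i"
    proof (cases u)
      case Nil
      then show ?thesis
        using der_lin_letter[of N "\<lambda>w. phi w n i" v a X b Y m] Suc.IH size_of
        by (simp add: madd_def msmul_def algebra_simps sum.distrib sum_distrib_left)
    next
      case (Cons l u')
      obtain Z p where l: "l = (Z, p)" by (cases l)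
      show ?thesis
        using linD[OF der_respects_linearity, of N "\<lambda>w. phi w n i" u' v Z p a X b Y m]
          linD[of N "\<lambda>w. phi w (n + p) _" u' v a X b Y m] Suc.IH size_of
        by (simp add: Cons l algebra_simps sum.distrib sum_distrib_left)
    qed
  qed
  \<comment> \<open>With this sign rule the case of a negative mode before a nonnegative one follows
    from the reverse order.\<close>
  have neg: "phi ((mbr Y X, q) # v) n i = - phi ((mbr X Y, q) # v) n i"
    if "length v \<le> N" for X Y q v n i
    using linD[OF respects_linearity, of "[]" v "- 1" "mbr X Y" 0 "mbr X Y" q n i] that
    unfolding mbr_antisym[of Y X] by simp
  have mixed: "phi ((X, m) # (Y, q) # v) n i =
      phi ((Y, q) # (X, m) # v) n i + phi ((mbr X Y, m + q) # v) n i + cocycle X m Y q * phi v n i"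
    if "m \<ge> 0" "q < 0" for X Y m q v n i
    using that by (simp add: der_sum)
  have "respects_commutation (Suc N) (\<lambda>w. phi w n i)" for n i
    unfolding respects_commutation_def
  proof (intro allI impI)
    fix u v :: word and X Y m q
    assume size_of: "length u + length v + 1 < Suc N"
    show "phi (u @ (X, m) # (Y, q) # v) n i - phi (u @ (Y, q) # (X, m) # v) n i
      - phi (u @ (mbr X Y, m + q) # v) n i - cocycle X m Y q * phi (u @ v) n i = 0"
    proof (cases u)
      case Nil
      consider "m < 0" "q < 0" | "m \<ge> 0" "q < 0" | "m < 0" "q \<ge> 0" | "m \<ge> 0" "q \<ge> 0" by linarith
      then show ?thesis
      proof cases
        case 1
        have swap: "(\<Sum>l\<in>idx. X i l * (\<Sum>j\<in>idx. Y l j * f j)) = (\<Sum>l\<in>idx. mmul X Y i l * f l)" for X Y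
            f
          unfolding mmul_def sum_distrib_left sum_distrib_right
          by (subst sum.swap) (simp add: mult.assoc)
        show ?thesis
          using 1 by (simp add: Nil cocycle_def swap mbr_def left_diff_distrib sum_subtractf
              algebra_simps)
      next
        case 2
        then show ?thesis using mixed[of m q X Y v n i] by (simp add: Nil)
      next
        case 3
        then show ?thesis
          using mixed[of q m Y X v n i] neg[of v Y X "q + m" n i] cocycle_antisym[of Y q X m]
              size_of
          by (simp add: Nil add.commute)
      next
        case 4
        \<comment> \<open>Nonnegative modes of sum 0 are both 0, and the cocycle has the factor
          m.\<close>
        have "cocycle X m Y q = 0"
          using 4 by (auto simp: cocycle_def add_nonneg_eq_0_iff)
        then show ?thesis
          using der_der[of N "\<lambda>w. phi w n i" v X m Y q] Suc.IH neg[of v Y X "q + m" n i] 4 size_of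
            cocycle_antisym[of Y q X m]
          by (simp add: Nil add.commute)
      qed
    next
      case (Cons l u')
      obtain Z p where l: "l = (Z, p)" by (cases l)
      have "(\<Sum>j\<in>idx. Z i j * (phi (u' @ (X, m) # (Y, q) # v) (n + p) j
          - phi (u' @ (Y, q) # (X, m) # v) (n + p) j - phi (u' @ (mbr X Y, m + q) # v) (n + p) j
          - cocycle X m Y q * phi (u' @ v) (n + p) j)) = 0"
        using cmmD[of N "\<lambda>w. phi w (n + p) _" u' v X m Y q] Suc.IH size_of by (simp add: Cons)
      then show ?thesis
        using cmmD[OF der_respects_commutation, of N "\<lambda>w. phi w n i" u' v Z p X m Y q] Suc.IH
            size_of
        by (simp add: Cons l algebra_simps sum_subtractf sum.distrib sum_distrib_left)
    qed
  qed
  with respects_linearity show ?case by blast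
qed

text \<open>The commutator of a nonnegative mode with the last letter is again a last letter of
  nonnegative mode, in a shorter word; its central term could only occur for two zero modes, where
  its factor vanishes. So induction on the length works with the last letter arbitrary.\<close>

lemma phi_vacuum: "m \<ge> 0 \<Longrightarrow> phi (u @ [(X, m)]) n i = 0"
proof (induction "length u" arbitrary: u X m n i rule: less_induct)
  case less
  show ?case
  proof (cases u)
    case (Cons l u')
    obtain Z p where l: "l = (Z, p)" by (cases l)
    have IH: "phi (u'' @ [(Y, q)]) n i = 0" if "length u'' \<le> length u'" "q \<ge> 0" for u'' Y q n i
      using less.hyps[of u''] that by (simp add: Cons)
    show ?thesis
    proof (cases "p < 0")
      case False
      have "der Z p (\<lambda>v. phi (v @ [(X, m)]) n i) u' = der Z p (\<lambda>v. 0) u'"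
        using less.prems by (intro der_cong refl IH) auto
      moreover have "cocycle Z p X m = 0"
        using False less.prems by (auto simp: cocycle_def add_nonneg_eq_0_iff)
      ultimately show ?thesis
        using False IH[of u' "p + m" "mbr Z X" n i] less.prems
        by (simp add: Cons l der_append der_0)
    qed (use IH less.prems in \<open>simp add: Cons l\<close>)
  qed (use less.prems in simp)
qed

section \<open>Linear extension of the functional and its vanishing on the kernel\<close>

definition phi_ext :: "tens \<Rightarrow> complex" where
  "phi_ext f = (\<Sum>w | f w \<noteq> 0. f w * phi w 6 1)"

lemma phi_ext_superset:
  "finite S \<Longrightarrow> {w. f w \<noteq> 0} \<subseteq> S \<Longrightarrow> phi_ext f = (\<Sum>w\<in>S. f w * phi w 6 1)"
  unfolding phi_ext_def by (rule sum.mono_neutral_left) auto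

text \<open>A sum over an infinite set counts as 0, so linearity of \<open>phi_ext\<close> is stated
  for finite supports.\<close>

definition fsupp :: "tens \<Rightarrow> bool" where "fsupp f \<longleftrightarrow> finite {w. f w \<noteq> 0}"

lemma fsupp_simps [simp]:
  "fsupp (mono w)" "fsupp 0" "fsupp f \<Longrightarrow> fsupp h \<Longrightarrow> fsupp (f + h)"
  "fsupp f \<Longrightarrow> fsupp h \<Longrightarrow> fsupp (f - h)" "fsupp f \<Longrightarrow> fsupp (tsmul c f)"
  "fsupp f \<Longrightarrow> fsupp (- f)"
proof -
  show "fsupp (mono w)" "fsupp 0"
    by (simp_all add: fsupp_def mono_def zero_fun_apply)
  show "fsupp (f + h)" "fsupp (f - h)" if "fsupp f" "fsupp h"
    using finite_UnI[OF that[unfolded fsupp_def]] unfolding fsupp_def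
    by (rule rev_finite_subset, force simp: pointwise)+
  show "fsupp (tsmul c f)" if "fsupp f"
    using that unfolding fsupp_def by (rule rev_finite_subset) (auto simp: tsmul_def)
  show "fsupp (- f)" if "fsupp f"
    using that by (simp add: fsupp_def uminus_apply)
qed

lemma phi_ext_mono [simp]: "phi_ext (mono w) = phi w 6 1"
  using phi_ext_superset[of "{w}" "mono w"] by (auto simp: mono_def)

lemma phi_ext_0 [simp]: "phi_ext 0 = 0"
  by (simp add: phi_ext_def zero_fun_apply)

lemma phi_ext_add [simp]:
  assumes "fsupp f" "fsupp h" shows "phi_ext (f + h) = phi_ext f + phi_ext h"
proof -
  let ?S = "{w. f w \<noteq> 0} \<union> {w. h w \<noteq> 0}"
  have *: "finite ?S" using assms by (simp add: fsupp_def)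
  show ?thesis
    by (subst (1 2 3) phi_ext_superset[OF *]) (auto simp: pointwise distrib_right sum.distrib)
qed

lemma phi_ext_smul [simp]:
  assumes "fsupp f" shows "phi_ext (tsmul c f) = c * phi_ext f"
  by (subst phi_ext_superset[OF assms[unfolded fsupp_def]])
    (auto simp: tsmul_def phi_ext_def sum_distrib_left mult.assoc)

lemma phi_ext_diff [simp]:
  assumes "fsupp f" "fsupp h" shows "phi_ext (f - h) = phi_ext f - phi_ext h"
  using phi_ext_add[of f "tsmul (- 1) h"] phi_ext_smul[of h "- 1"] assms by simp

lemma phi_ext_vkker: "f \<in> vkker g nform k \<Longrightarrow> fsupp f \<and> phi_ext f = 0"
proof (induction rule: vkker.induct)
  case zero
  show ?case unfolding zero_fun_def[symmetric] by simp
next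
  case (rel r u v)
  let ?N = "Suc (Suc (length u + length v))"
  from rel(1) show ?case
    unfolding affrel_def
  proof (elim UnE CollectE exE conjE)
    fix a b X Y n
    assume "r = tsub (tsub (mono [(madd (msmul a X) (msmul b Y), n)]) (tsmul a (mono [(X, n)])))
      (tsmul b (mono [(Y, n)]))"
    then have "lmul u (rmul r v) = mono (u @ (madd (msmul a X) (msmul b Y), n) # v)
        - tsmul a (mono (u @ (X, n) # v)) - tsmul b (mono (u @ (Y, n) # v))"
      by (simp add: tsub_eq)
    moreover have "phi (u @ (madd (msmul a X) (msmul b Y), n) # v) 6 1 =
        a * phi (u @ (X, n) # v) 6 1 + b * phi (u @ (Y, n) # v) 6 1"
      by (rule linD[OF conjunct1[OF phi_lin_respects_commutation[of ?N]]]) simp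
    ultimately show ?thesis
      by (simp only: phi_ext_diff phi_ext_smul phi_ext_mono fsupp_simps) simp
  next
    fix X Y m n
    assume "r = tsub (tsub (tsub (mono [(X, m), (Y, n)]) (mono [(Y, n), (X, m)]))
      (mono [(mbr X Y, m + n)])) (tsmul (if m + n = 0 then of_int m * nform X Y * k else 0) (mono
          []))"
    then have "lmul u (rmul r v) = mono (u @ (X, m) # (Y, n) # v) - mono (u @ (Y, n) # (X, m) # v)
        - mono (u @ (mbr X Y, m + n) # v) - tsmul (cocycle X m Y n) (mono (u @ v))"
      by (simp add: tsub_eq cocycle_def[symmetric])
    moreover have "phi (u @ (X, m) # (Y, n) # v) 6 1 - phi (u @ (Y, n) # (X, m) # v) 6 1
        - phi (u @ (mbr X Y, m + n) # v) 6 1 - cocycle X m Y n * phi (u @ v) 6 1 = 0"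
      by (rule cmmD[OF conjunct2[OF phi_lin_respects_commutation[of ?N]]]) simp
    ultimately show ?thesis
      by (simp only: phi_ext_diff phi_ext_smul phi_ext_mono fsupp_simps)
  qed
next
  case (add f h)
  then show ?case by (simp only: tadd_eq fsupp_simps phi_ext_add add_0 simp_thms)
qed (simp_all add: phi_vacuum)

lemma phi_ext_keq: "vkeq g nform k f 0 \<Longrightarrow> phi_ext f = 0"
  using phi_ext_vkker[of f g] by (simp add: keq_iff)

end

section \<open>Rewriting of diagrams\<close>

text \<open>
  \<open>L m i b j d\<close> stands for \<open>J x y (m)\<close> whose indices are the values of the labels \<open>i\<close>
  and \<open>j\<close>, replaced by their duals \<open>9 - _\<close> if the flags \<open>b\<close> and \<open>d\<close> are set. Labels
  \<open>0,\<dots>,3\<close> are the fixed indices \<open>1,\<dots>,4\<close>; labels \<open>4,\<dots>,11\<close> are summed over.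

  Conditionals whose branches contain large data are split off into functions by pattern matching:
  the simplifier normalises again whatever it meets in a branch of a case distinction.
\<close>

datatype letter_shape = L int nat bool nat bool
type_synonym diagram = "letter_shape list"
type_synonym lincomb = "(int \<times> diagram) list"
datatype ordering = LT | EQ | GT

fun cmp_nat :: "nat \<Rightarrow> nat \<Rightarrow> ordering" where
  "cmp_nat 0 0 = EQ"
| "cmp_nat 0 (Suc n) = LT"
| "cmp_nat (Suc m) 0 = GT"
| "cmp_nat (Suc m) (Suc n) = cmp_nat m n"

definition eq_nat :: "nat \<Rightarrow> nat \<Rightarrow> bool" where "eq_nat m n = (cmp_nat m n = EQ)"

lemma cmp_nat_EQ: "cmp_nat m n = EQ \<longleftrightarrow> m = n"
  by (induction m n rule: cmp_nat.induct) auto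

lemma eq_nat_iff [simp]: "eq_nat m n \<longleftrightarrow> m = n"
  by (simp add: eq_nat_def cmp_nat_EQ)

lemma eq_nat_code [code]:
  "eq_nat 0 0 = True" "eq_nat 0 (Suc n) = False" "eq_nat (Suc m) 0 = False" "eq_nat (Suc m) (Suc n)
      = eq_nat m n"
  by simp_all

fun xor :: "bool \<Rightarrow> bool \<Rightarrow> bool" where
  "xor True True = False" | "xor True False = True" | "xor False b = b"

lemma xor_iff [simp]: "xor b c \<longleftrightarrow> b \<noteq> c"
  by (cases b; cases c) simp_all

fun internal :: "nat \<Rightarrow> bool" where
  "internal 0 = False" | "internal (Suc 0) = False" | "internal (Suc (Suc 0)) = False"
| "internal (Suc (Suc (Suc 0))) = False"
| "internal (Suc (Suc (Suc (Suc n)))) = (n < 8)"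

lemma internal_iff: "internal i \<longleftrightarrow> 4 \<le> i \<and> i < 12"
  by (induction i rule: internal.induct) auto

fun rev_append :: "diagram \<Rightarrow> diagram \<Rightarrow> diagram" where
  "rev_append [] v = v" | "rev_append (l # u) v = rev_append u (l # v)"

lemma rev_append_eq [simp]: "rev_append u v = rev u @ v"
  by (induction u v rule: rev_append.induct) simp_all

fun rename_label :: "bool \<Rightarrow> nat \<Rightarrow> nat \<Rightarrow> nat" where "rename_label True a j = j" | "rename_label False
    a j = a"
fun rename_flag :: "bool \<Rightarrow> bool \<Rightarrow> bool \<Rightarrow> bool" where "rename_flag True b f = xor b f" | "rename_flag
    False b f = b"

fun substitute :: "nat \<Rightarrow> nat \<Rightarrow> bool \<Rightarrow> diagram \<Rightarrow> diagram" where
  "substitute i j f [] = []"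
| "substitute i j f (L m a b c d # w) = L m (rename_label (eq_nat a i) a j) (rename_flag (eq_nat a
    i) b f)
     (rename_label (eq_nat c i) c j) (rename_flag (eq_nat c i) d f) # substitute i j f w"

text \<open>With the normalisation of \<open>diagram_tens\<close> below, contracting two labels costs the
  coefficient 1 if a summation index disappears from the diagram, and 8 otherwise.\<close>

fun contract2 :: "bool \<Rightarrow> diagram \<Rightarrow> (int \<times> diagram) option" where
  "contract2 True w = Some (8, w)" | "contract2 False w = None"

fun contract3 :: "bool \<Rightarrow> bool \<Rightarrow> nat \<Rightarrow> nat \<Rightarrow> bool \<Rightarrow> diagram \<Rightarrow> (int \<times> diagram) option" where
  "contract3 True q i j f w = Some (1, substitute i j f w)"
| "contract3 False True i j f w = Some (1, substitute j i f w)"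
| "contract3 False False i j f w = contract2 (eq_nat (rename_label (i < 12) 0 i) (rename_label (j <
    12) 0 j) \<and> \<not> f) w"

fun contract1 :: "bool \<Rightarrow> nat \<Rightarrow> bool \<Rightarrow> nat \<Rightarrow> bool \<Rightarrow> diagram \<Rightarrow> (int \<times> diagram) option" where
  "contract1 True i b j c w = contract2 (xor b c) w"
| "contract1 False i b j c w = contract3 (internal i) (internal j) i j (\<not> xor b c) w"

definition contract :: "nat \<Rightarrow> bool \<Rightarrow> nat \<Rightarrow> bool \<Rightarrow> diagram \<Rightarrow> (int \<times> diagram) option" where
  "contract i b j c w = contract1 (eq_nat i j) i b j c w"

fun add_contraction :: "int \<Rightarrow> (int \<times> diagram) option \<Rightarrow> lincomb \<Rightarrow> lincomb" where
  "add_contraction k None acc = acc" | "add_contraction k (Some (x, w)) acc = (k * x, w) # acc"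

fun add_contraction2 :: "int \<Rightarrow> (int \<times> diagram) option \<Rightarrow> lincomb \<Rightarrow> lincomb" where
  "add_contraction2 k None acc = acc"
| "add_contraction2 k (Some (x, [])) acc = acc"
| "add_contraction2 k (Some (x, L m a d e f # w)) acc = add_contraction (k * x) (contract a d e f w)
    acc"

text \<open>Two letters disappear, releasing 24^2 = 64 * 9. The two contractions absorb 64, and 9
  times the level -14/3 is -42. The inserted letter of mode 0 is only a carrier: it takes the labels
  of the second metric through the substitution made by the first contraction and is then
  consumed.\<close>

fun central :: "bool \<Rightarrow> int \<Rightarrow> nat \<Rightarrow> bool \<Rightarrow> nat \<Rightarrow> bool \<Rightarrow> nat \<Rightarrow> bool \<Rightarrow> nat \<Rightarrow> bool \<Rightarrow> diagram \<Rightarrow> lincomb"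
    where
  "central False c i b j d k e l f w = []"
| "central True c i b j d k e l f w =
     add_contraction2 (-42 * c) (contract j d k e (L 0 i b l f # w))
     (add_contraction2 (42 * c) (contract i b k e (L 0 j d l f # w)) [])"

text \<open>One letter disappears, releasing 24 = 8 * 3; the contraction absorbs 8 and leaves the
  3.\<close>

fun bracket :: "int \<Rightarrow> diagram \<Rightarrow> letter_shape \<Rightarrow> letter_shape \<Rightarrow> diagram \<Rightarrow> lincomb" where
  "bracket c u (L m i b j d) (L n k e l f) v =
     add_contraction (3 * c) (contract j d k e (rev_append u (L (m + n) i b l f # v)))
     (add_contraction (-3 * c) (contract i b k e (rev_append u (L (m + n) j d l f # v)))
     (add_contraction (-3 * c) (contract j d l f (rev_append u (L (m + n) i b k e # v)))
     (add_contraction (3 * c) (contract i b l f (rev_append u (L (m + n) j d k e # v)))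
     (central (m + n = 0) (m * c) i b j d k e l f (rev_append u v)))))"

section \<open>Orders on letters and diagrams\<close>

fun cmp_bool :: "bool \<Rightarrow> bool \<Rightarrow> ordering" where
  "cmp_bool True True = EQ" | "cmp_bool False False = EQ" | "cmp_bool False True = LT" | "cmp_bool
      True False = GT"

fun then_cmp :: "ordering \<Rightarrow> ordering \<Rightarrow> ordering" where
  "then_cmp LT y = LT" | "then_cmp EQ y = y" | "then_cmp GT y = GT"

fun cmp_mode :: "bool \<Rightarrow> bool \<Rightarrow> ordering" where
  "cmp_mode True e = LT" | "cmp_mode False True = EQ" | "cmp_mode False False = GT"

fun cmp_letter :: "letter_shape \<Rightarrow> letter_shape \<Rightarrow> ordering" where
  "cmp_letter (L m i b j d) (L n k e l f) =
     then_cmp (cmp_mode (m < n) (m = n)) (then_cmp (cmp_nat i k) (then_cmp (cmp_nat j l) (then_cmp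
         (cmp_bool b e) (cmp_bool d f))))"

fun cmp_diagram :: "diagram \<Rightarrow> diagram \<Rightarrow> ordering" where
  "cmp_diagram [] [] = EQ" | "cmp_diagram [] (l # w) = LT" | "cmp_diagram (l # w) [] = GT"
| "cmp_diagram (l # w) (k # v) = (case cmp_letter l k of LT \<Rightarrow> LT | EQ \<Rightarrow> cmp_diagram w v | GT \<Rightarrow> GT)"

definition cmp_diagram1 :: "ordering \<Rightarrow> diagram \<Rightarrow> diagram \<Rightarrow> ordering" where
  "cmp_diagram1 x w v = (case x of LT \<Rightarrow> LT | EQ \<Rightarrow> cmp_diagram w v | GT \<Rightarrow> GT)"

lemma cmp_diagram_code [code]:
  "cmp_diagram [] [] = EQ" "cmp_diagram [] (l # w) = LT" "cmp_diagram (l # w) [] = GT"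
  "cmp_diagram (l # w) (k # v) = cmp_diagram1 (cmp_letter l k) w v"
  "cmp_diagram1 LT w v = LT" "cmp_diagram1 EQ w v = cmp_diagram w v" "cmp_diagram1 GT w v = GT"
  by (simp_all add: cmp_diagram1_def)

lemma cmp_diagram_EQ: "cmp_diagram w v = EQ \<Longrightarrow> w = v"
proof (induction w v rule: cmp_diagram.induct)
  case (4 l w k v)
  have then_cmp: "then_cmp x y = EQ \<longleftrightarrow> x = EQ \<and> y = EQ" for x y by (cases x) auto
  have "cmp_bool b c = EQ \<longleftrightarrow> b = c" for b c by (cases b; cases c) auto
  moreover have "cmp_mode b c = EQ \<longleftrightarrow> \<not> b \<and> c" for b c by (cases b; cases c) auto
  ultimately show ?case
    using 4 by (cases l; cases k) (auto simp: then_cmp cmp_nat_EQ split: ordering.splits)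
qed auto

text \<open>Labels are renamed in the order of first occurrence and letters are oriented by antisymmetry;
  the result is \<open>None\<close> if the diagram is seen to vanish.\<close>

type_synonym renaming = "(nat \<times> nat \<times> bool) list"

fun look_up0 :: "bool \<Rightarrow> nat \<Rightarrow> (nat \<times> bool) option" where
  "look_up0 True i = None" | "look_up0 False i = Some (i, False)"

fun look_up :: "nat \<Rightarrow> renaming \<Rightarrow> (nat \<times> bool) option" where
  "look_up i [] = look_up0 (internal i) i"
| "look_up i ((a, r) # s) = (if eq_nat a i then Some r else look_up i s)"

text \<open>If both labels of a letter are new, antisymmetry makes their order arbitrary. The lower
  name goes to the label that recurs first in the rest of the diagram.\<close>

fun first_occ :: "nat \<Rightarrow> nat \<Rightarrow> diagram \<Rightarrow> ordering" where
  "first_occ i j [] = EQ"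
| "first_occ i j (L m a b c d # w) = (if eq_nat a i \<or> eq_nat c i then LT else if eq_nat a j \<or> eq_nat
    c j then GT else first_occ i j w)"

text \<open>Next free label, renaming so far, sign (\<open>True\<close> for plus) and output in
  reverse. A renaming sends an old label to a new one and a flag saying whether it is
  dualised.\<close>

type_synonym canon_state = "nat \<times> renaming \<times> bool \<times> diagram"

fun canon2 :: "ordering \<Rightarrow> bool \<Rightarrow> bool \<Rightarrow> nat \<Rightarrow> nat \<Rightarrow> nat \<Rightarrow> renaming \<Rightarrow> bool \<Rightarrow> diagram \<Rightarrow> int \<Rightarrow>
    canon_state option" where
  "canon2 LT b d i j n s sg u m = Some (n, s, sg, L m i b j d # u)"
| "canon2 GT b d i j n s sg u m = Some (n, s, \<not> sg, L m j d i b # u)"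
| "canon2 EQ False True i j n s sg u m = Some (n, s, sg, L m i False j True # u)"
| "canon2 EQ True False i j n s sg u m = Some (n, s, \<not> sg, L m j False i True # u)"
| "canon2 EQ True True i j n s sg u m = None"
| "canon2 EQ False False i j n s sg u m = None"

fun canon3 :: "bool \<Rightarrow> ordering \<Rightarrow> nat \<Rightarrow> renaming \<Rightarrow> bool \<Rightarrow> diagram \<Rightarrow> int \<Rightarrow> nat \<Rightarrow> bool \<Rightarrow> nat \<Rightarrow> bool \<Rightarrow>
    canon_state option" where
  "canon3 True EQ n s sg u m i b j d = None"
| "canon3 True LT n s sg u m i b j d = Some (Suc n, (i, n, b) # s, sg, L m n False n (xor d b) # u)"
| "canon3 True GT n s sg u m i b j d = Some (Suc n, (i, n, b) # s, sg, L m n False n (xor d b) # u)"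
| "canon3 False GT n s sg u m i b j d =
     Some (Suc (Suc n), (i, Suc n, b) # (j, n, d) # s, \<not> sg, L m n False (Suc n) False # u)"
| "canon3 False LT n s sg u m i b j d =
     Some (Suc (Suc n), (j, Suc n, d) # (i, n, b) # s, sg, L m n False (Suc n) False # u)"
| "canon3 False EQ n s sg u m i b j d =
     Some (Suc (Suc n), (j, Suc n, d) # (i, n, b) # s, sg, L m n False (Suc n) False # u)"

fun canon1 :: "(nat \<times> bool) option \<Rightarrow> (nat \<times> bool) option \<Rightarrow> nat \<Rightarrow> renaming \<Rightarrow> bool \<Rightarrow> diagram \<Rightarrow>
    int \<Rightarrow> nat \<Rightarrow> bool \<Rightarrow> nat \<Rightarrow> bool \<Rightarrow> diagram \<Rightarrow> canon_state option" where
  "canon1 (Some (i', f)) (Some (j', g)) n s sg u m i b j d w =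
     canon2 (cmp_nat i' j') (xor b f) (xor d g) i' j' n s sg u m"
| "canon1 (Some (i', f)) None n s sg u m i b j d w =
     Some (Suc n, (j, n, d) # s, sg, L m i' (xor b f) n False # u)"
| "canon1 None (Some (j', g)) n s sg u m i b j d w =
     Some (Suc n, (i, n, b) # s, \<not> sg, L m j' (xor d g) n False # u)"
| "canon1 None None n s sg u m i b j d w = canon3 (eq_nat i j) (first_occ i j w) n s sg u m i b j d"

fun canon_loop :: "canon_state option \<Rightarrow> diagram \<Rightarrow> (bool \<times> diagram) option" where
  "canon_loop None w = None"
| "canon_loop (Some (n, s, sg, u)) [] = Some (sg, rev_append u [])"
| "canon_loop (Some (n, s, sg, u)) (L m i b j d # w) = canon_loop (canon1 (look_up i s) (look_up j
    s) n s sg u m i b j d w) w"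

definition canonical :: "diagram \<Rightarrow> (bool \<times> diagram) option" where
  "canonical w = canon_loop (Some (Suc (Suc (Suc (Suc 0))), [], True, [])) w"

text \<open>A search tree of pending terms in which like terms merge. The number of letters comes
  first in the key, so the maximum is a longest diagram: the commutator terms which long diagrams
  contribute to shorter ones are collected before the shorter ones are rewritten.\<close>

datatype tree = Leaf | Node tree nat diagram int tree

fun cmp_key :: "ordering \<Rightarrow> diagram \<Rightarrow> diagram \<Rightarrow> ordering" where
  "cmp_key LT w v = LT" | "cmp_key EQ w v = cmp_diagram w v" | "cmp_key GT w v = GT"

fun insert_term :: "nat \<Rightarrow> diagram \<Rightarrow> int \<Rightarrow> tree \<Rightarrow> tree" where
  "insert_term n w c Leaf = Node Leaf n w c Leaf"
| "insert_term n w c (Node l m v d r) = (case cmp_key (cmp_nat n m) w v of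
     LT \<Rightarrow> Node (insert_term n w c l) m v d r
   | EQ \<Rightarrow> Node l m v (d + c) r
   | GT \<Rightarrow> Node l m v d (insert_term n w c r))"

definition insert_term1 :: "ordering \<Rightarrow> nat \<Rightarrow> diagram \<Rightarrow> int \<Rightarrow> tree \<Rightarrow> nat \<Rightarrow> diagram \<Rightarrow> int \<Rightarrow> tree \<Rightarrow>
    tree" where
  "insert_term1 x n w c l m v d r = (case x of
     LT \<Rightarrow> Node (insert_term n w c l) m v d r
   | EQ \<Rightarrow> Node l m v (d + c) r
   | GT \<Rightarrow> Node l m v d (insert_term n w c r))"

lemma insert_term_code [code]:
  "insert_term n w c Leaf = Node Leaf n w c Leaf"
  "insert_term n w c (Node l m v d r) = insert_term1 (cmp_key (cmp_nat n m) w v) n w c l m v d r"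
  "insert_term1 LT n w c l m v d r = Node (insert_term n w c l) m v d r"
  "insert_term1 EQ n w c l m v d r = Node l m v (d + c) r"
  "insert_term1 GT n w c l m v d r = Node l m v d (insert_term n w c r)"
  by (simp_all add: insert_term1_def)

fun size_of :: "diagram \<Rightarrow> nat" where "size_of [] = 0" | "size_of (l # w) = Suc (size_of w)"

fun signed :: "bool \<Rightarrow> int \<Rightarrow> int" where "signed True c = c" | "signed False c = - c"

fun insert_canonical :: "(bool \<times> diagram) option \<Rightarrow> int \<Rightarrow> tree \<Rightarrow> tree" where
  "insert_canonical None c t = t"
| "insert_canonical (Some (s, w)) c t = insert_term (size_of w) w (signed s c) t"

fun insert_all :: "lincomb \<Rightarrow> tree \<Rightarrow> tree" where
  "insert_all [] t = t"
| "insert_all ((c, w) # ts) t = insert_all ts (insert_canonical (canonical w) c t)"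

fun pop_max1 :: "diagram \<times> int \<times> tree \<Rightarrow> tree \<Rightarrow> nat \<Rightarrow> diagram \<Rightarrow> int \<Rightarrow> diagram \<times> int \<times> tree" where
  "pop_max1 (v, d, t) l n w c = (v, d, Node l n w c t)"

fun pop_max :: "tree \<Rightarrow> nat \<Rightarrow> diagram \<Rightarrow> int \<Rightarrow> tree \<Rightarrow> diagram \<times> int \<times> tree" where
  "pop_max l n w c Leaf = (w, c, l)"
| "pop_max l n w c (Node l' n' w' c' r') = pop_max1 (pop_max l' n' w' c' r') l n w c"

section \<open>Rewrite rules and their iteration\<close>

definition swap_terms :: "int \<Rightarrow> diagram \<Rightarrow> letter_shape \<Rightarrow> letter_shape \<Rightarrow> diagram \<Rightarrow> lincomb" where
  "swap_terms c u k l v = (c, rev_append u (l # k # v)) # bracket c u k l v"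

fun mode :: "letter_shape \<Rightarrow> int" where "mode (L m i b j d) = m"

text \<open>The letter given here has nonnegative mode; in last place it kills the vacuum, hence the
  empty combination.\<close>

fun push_right2 :: "int \<Rightarrow> diagram \<Rightarrow> letter_shape \<Rightarrow> diagram \<Rightarrow> lincomb" where
  "push_right2 c u l [] = []" | "push_right2 c u l (k # v) = swap_terms c u l k v"

fun push_right :: "int \<Rightarrow> diagram \<Rightarrow> diagram \<Rightarrow> lincomb option" where
  "push_right c u [] = None"
| "push_right c u (l # w) = (if mode l < 0 then push_right c (l # u) w else Some (push_right2 c u l
    w))"

definition push_right1 :: "bool \<Rightarrow> int \<Rightarrow> diagram \<Rightarrow> letter_shape \<Rightarrow> diagram \<Rightarrow> lincomb option" where
  "push_right1 b c u l w = (if b then push_right c (l # u) w else Some (push_right2 c u l w))"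

lemma push_right_code [code]:
  "push_right c u [] = None" "push_right c u (l # w) = push_right1 (mode l < 0) c u l w"
  "push_right1 True c u l w = push_right c (l # u) w" "push_right1 False c u l w = Some (push_right2
      c u l w)"
  by (simp_all add: push_right1_def)

fun sort_modes :: "int \<Rightarrow> diagram \<Rightarrow> diagram \<Rightarrow> lincomb option" where
  "sort_modes c u [] = None"
| "sort_modes c u [k] = None"
| "sort_modes c u (k # l # w) = (if mode l < mode k then Some (swap_terms c u k l w) else sort_modes
    c (k # u) (l # w))"

definition sort_modes1 :: "bool \<Rightarrow> int \<Rightarrow> diagram \<Rightarrow> letter_shape \<Rightarrow> letter_shape \<Rightarrow> diagram \<Rightarrow> lincomb
    option" where
  "sort_modes1 b c u k l w = (if b then Some (swap_terms c u k l w) else sort_modes c (k # u) (l #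
      w))"

lemma sort_modes_code [code]:
  "sort_modes c u [] = None" "sort_modes c u [k] = None"
  "sort_modes c u (k # l # w) = sort_modes1 (mode l < mode k) c u k l w"
  "sort_modes1 True c u k l w = Some (swap_terms c u k l w)"
  "sort_modes1 False c u k l w = sort_modes c (k # u) (l # w)"
  by (simp_all add: sort_modes1_def)

text \<open>If exchanging two letters of equal mode gives minus the same diagram, then the diagram is half
  of the commutator term.\<close>

fun try_swap2 :: "bool \<Rightarrow> int \<Rightarrow> diagram \<Rightarrow> letter_shape \<Rightarrow> letter_shape \<Rightarrow> diagram \<Rightarrow> lincomb option"
    where
  "try_swap2 True c u k l w = Some (bracket (c div 2) u k l w)"
| "try_swap2 False c u k l w = None"

fun try_swap1 :: "ordering \<Rightarrow> bool \<Rightarrow> int \<Rightarrow> diagram \<Rightarrow> letter_shape \<Rightarrow> letter_shape \<Rightarrow> diagram \<Rightarrow> lincomb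
    option" where
  "try_swap1 LT s c u k l w = Some (swap_terms c u k l w)"
| "try_swap1 GT s c u k l w = None"
| "try_swap1 EQ True c u k l w = None"
| "try_swap1 EQ False c u k l w = try_swap2 (even c) c u k l w"

fun try_swap :: "(bool \<times> diagram) option \<Rightarrow> diagram \<Rightarrow> int \<Rightarrow> diagram \<Rightarrow> letter_shape \<Rightarrow> letter_shape \<Rightarrow>
    diagram \<Rightarrow> lincomb option" where
  "try_swap None z c u k l w = None"
| "try_swap (Some (s, z')) z c u k l w = try_swap1 (cmp_diagram z' z) s c u k l w"

text \<open>Renaming does not see symmetries that permute letters, such as rotations of a trace.
  Exchanging neighbours of equal mode realises them, and an exchange is accepted if the canonical
  form decreases.\<close>

fun try_swaps :: "int \<Rightarrow> diagram \<Rightarrow> diagram \<Rightarrow> diagram \<Rightarrow> lincomb option" where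
  "try_swaps c z u [] = None"
| "try_swaps c z u [k] = None"
| "try_swaps c z u (k # l # w) = (if mode k = mode l then
     (case try_swap (canonical (rev_append u (l # k # w))) z c u k l w of
        Some r \<Rightarrow> Some r
      | None \<Rightarrow> try_swaps c z (k # u) (l # w))
     else try_swaps c z (k # u) (l # w))"

definition try_swaps2 :: "lincomb option \<Rightarrow> int \<Rightarrow> diagram \<Rightarrow> diagram \<Rightarrow> letter_shape \<Rightarrow> letter_shape \<Rightarrow>
    diagram \<Rightarrow> lincomb option" where
  "try_swaps2 r c z u k l w = (case r of Some r \<Rightarrow> Some r | None \<Rightarrow> try_swaps c z (k # u) (l # w))"

definition try_swaps1 :: "bool \<Rightarrow> int \<Rightarrow> diagram \<Rightarrow> diagram \<Rightarrow> letter_shape \<Rightarrow> letter_shape \<Rightarrow> diagram \<Rightarrow>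
    lincomb option" where
  "try_swaps1 b c z u k l w = (if b then try_swaps2 (try_swap (canonical (rev_append u (l # k # w)))
      z c u k l w) c z u k l w
     else try_swaps c z (k # u) (l # w))"

lemma try_swaps_code [code]:
  "try_swaps c z u [] = None" "try_swaps c z u [k] = None"
  "try_swaps c z u (k # l # w) = try_swaps1 (mode k = mode l) c z u k l w"
  "try_swaps1 True c z u k l w = try_swaps2 (try_swap (canonical (rev_append u (l # k # w))) z c u k
      l w) c z u k l w"
  "try_swaps1 False c z u k l w = try_swaps c z (k # u) (l # w)"
  "try_swaps2 (Some r) c z u k l w = Some r"
  "try_swaps2 None c z u k l w = try_swaps c z (k # u) (l # w)"
  by (simp_all add: try_swaps1_def try_swaps2_def)

fun rewrite_step2 :: "lincomb option \<Rightarrow> int \<Rightarrow> diagram \<Rightarrow> lincomb option" where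
  "rewrite_step2 (Some r) c w = Some r" | "rewrite_step2 None c w = try_swaps c w [] w"

fun rewrite_step1 :: "lincomb option \<Rightarrow> int \<Rightarrow> diagram \<Rightarrow> lincomb option" where
  "rewrite_step1 (Some r) c w = Some r" | "rewrite_step1 None c w = rewrite_step2 (sort_modes c []
      w) c w"

definition rewrite_step :: "int \<Rightarrow> diagram \<Rightarrow> lincomb option" where "rewrite_step c w = rewrite_step1
    (push_right c [] w) c w"

text \<open>An irreducible term is put back at the right end, where the next step pops it again. The
  tree is then a fixed point different from \<open>Leaf\<close>, so a failure cannot pass as
  success.\<close>

fun reduce4 :: "lincomb option \<Rightarrow> diagram \<Rightarrow> int \<Rightarrow> tree \<Rightarrow> tree" where
  "reduce4 (Some ts) w c t = insert_all ts t" | "reduce4 None w c t = Node t 0 w c Leaf"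

fun reduce3 :: "bool \<Rightarrow> diagram \<Rightarrow> int \<Rightarrow> tree \<Rightarrow> tree" where
  "reduce3 True w c t = t" | "reduce3 False w c t = reduce4 (rewrite_step c w) w c t"

fun reduce2 :: "diagram \<times> int \<times> tree \<Rightarrow> tree" where "reduce2 (w, c, t) = reduce3 (c = 0) w c t"

fun reduce1 :: "tree \<Rightarrow> tree" where
  "reduce1 Leaf = Leaf" | "reduce1 (Node l k w c r) = reduce2 (pop_max l k w c r)"

text \<open>Doubling gives 2^n steps from a small counter; steps on an empty tree do
  nothing.\<close>

fun reduce :: "nat \<Rightarrow> tree \<Rightarrow> tree" where
  "reduce 0 t = reduce1 t" | "reduce (Suc n) t = reduce n (reduce n t)"

fun next_label :: "nat \<Rightarrow> nat" where
  "next_label (Suc (Suc (Suc (Suc n)))) = Suc (Suc (Suc (Suc (Suc n))))" | "next_label _ = 4"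

fun chain :: "nat \<Rightarrow> bool \<Rightarrow> int list \<Rightarrow> diagram \<Rightarrow> diagram" where
  "chain n b [] w = w"
| "chain n b [m] w = L (- m) n b 0 False # w"
| "chain n b (m # m' # ms) w = L (- m) n b (next_label n) False # chain (next_label n) True (m' #
    ms) w"

fun cycle :: "nat \<Rightarrow> nat \<Rightarrow> int list \<Rightarrow> diagram \<Rightarrow> diagram" where
  "cycle e n [] w = w"
| "cycle e n [m] w = L (- m) n True e False # w"
| "cycle e n (m # m' # ms) w = L (- m) n True (Suc n) False # cycle e (Suc n) (m' # ms) w"

text \<open>Label 0 at both ends of the chain is the index 1. In the vector below a chain next to a
  trace has at most four letters and uses the labels 4, 5, 6; a trace thus starts at 7, and a second
  one, after a trace of two letters, at 9. All labels stay below 12.\<close>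

fun mk_diagram :: "int list \<Rightarrow> int list list \<Rightarrow> diagram" where
  "mk_diagram c [] = chain 0 False c []"
| "mk_diagram c [t] = chain 0 False c (cycle 7 7 t [])"
| "mk_diagram c (t # t' # _) = chain 0 False c (cycle 7 7 t (cycle 9 9 t' []))"

section \<open>Soundness of the rewriting\<close>

definition label_range :: "nat \<Rightarrow> nat set" where
  "label_range i = (if internal i then idx else {if i < 4 then i + 1 else 1})"

definition assignments :: "(nat \<Rightarrow> nat) set" where
  "assignments = {r. \<forall>i. r i \<in> label_range i}"

lemma label_range_idx: "label_range i \<subseteq> idx"
  by (auto simp: label_range_def idx_def)

lemma assignments_idx: "r \<in> assignments \<Longrightarrow> r i \<in> idx"
  using label_range_idx by (auto simp: assignments_def)

lemma rhoD: "r \<in> assignments \<Longrightarrow> r i \<in> label_range i"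
  by (simp add: assignments_def)

lemma assignments_upd: "r \<in> assignments \<Longrightarrow> internal i \<Longrightarrow> a \<in> idx \<Longrightarrow> r(i := a) \<in> assignments"
  by (simp add: assignments_def) (simp add: label_range_def)

lemma assignments_external: "r \<in> assignments \<Longrightarrow> \<not> internal i \<Longrightarrow> r i = (if i < 4 then i + 1 else 1)"
  using rhoD[of r i] by (auto simp: label_range_def)

lemma finite_assignments: "finite assignments"
proof -
  let ?F = "{f. \<forall>i :: nat. (i \<in> {4..<12} \<longrightarrow> f i \<in> idx) \<and> (i \<notin> {4..<12} \<longrightarrow> f i = (0 :: nat))}"
  let ?g = "\<lambda>f i. if internal i then f i else if i < 4 then i + 1 else 1"
  have "finite ?F"
    by (rule finite_set_of_finite_funs) (simp_all add: idx_def)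
  moreover have "r \<in> ?g ` ?F" if "r \<in> assignments" for r
  proof (rule image_eqI)
    show "r = ?g (\<lambda>i. if internal i then r i else 0)"
      using assignments_external[OF that] by (auto simp: fun_eq_iff)
    show "(\<lambda>i. if internal i then r i else 0) \<in> ?F"
      using assignments_idx[OF that] by (auto simp: internal_iff)
  qed
  ultimately show ?thesis
    using finite_subset[of assignments "?g ` ?F"] by blast
qed

definition slot_index :: "(nat \<Rightarrow> nat) \<Rightarrow> nat \<Rightarrow> bool \<Rightarrow> nat" where
  "slot_index r i b = (if b then 9 - r i else r i)"

lemma slot_index_idx: "r \<in> assignments \<Longrightarrow> slot_index r i b \<in> idx"
  using assignments_idx[of r i] by (simp add: slot_index_def)

lemma slot_index_val: "r \<in> assignments \<Longrightarrow> (if b then 9 - slot_index r i f else slot_index r i f) =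
    slot_index r i (b \<noteq> f)"
  using assignments_idx[of r i] by (auto simp: slot_index_def idx_def)

lemma metric_slot_index:
  assumes "r \<in> assignments"
  shows "metric (slot_index r i b) (slot_index r j c) = of_bool (r i = slot_index r j (b = c))"
  using assignments_idx[OF assms, of i] assignments_idx[OF assms, of j]
  by (auto simp: metric_def slot_index_def idx_def)

type_synonym index_word = "(int \<times> nat \<times> nat) list"

fun eval_diagram :: "(nat \<Rightarrow> nat) \<Rightarrow> diagram \<Rightarrow> index_word" where
  "eval_diagram r [] = []"
| "eval_diagram r (L m i b j d # w) = (m, slot_index r i b, slot_index r j d) # eval_diagram r w"

lemma eval_diagram_append [simp]: "eval_diagram r (u @ v) = eval_diagram r u @ eval_diagram r v"
  by (induction r u rule: eval_diagram.induct) simp_all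

text \<open>Once \<open>r i\<close> is replaced by \<open>t r\<close>, its old value is free and has
  eight possibilities: an assignment corresponds to the pair of its updated version and the old
  value at \<open>i\<close>.\<close>

lemma sum_rho_upd:
  fixes G :: "(nat \<Rightarrow> nat) \<Rightarrow> complex"
  assumes i: "internal i" and t: "\<And>r. r \<in> assignments \<Longrightarrow> t r \<in> idx" "\<And>r a. t (r(i := a)) = t r"
  shows "8 * (\<Sum>r\<in>assignments. of_bool (r i = t r) * G r) = (\<Sum>r\<in>assignments. G (r(i := t r)))"
proof -
  let ?R = "{r \<in> assignments. r i = t r}"
  have "(\<Sum>r\<in>assignments. G (r(i := t r))) = (\<Sum>(r, a)\<in>?R \<times> idx. G r)"
  proof (rule sum.reindex_bij_witness[where i = "\<lambda>(r, a). r(i := a)" and j = "\<lambda>r. (r(i := t r), r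
      i)"])
    fix r assume "r \<in> assignments"
    then show "(case (r(i := t r), r i) of (r, a) \<Rightarrow> r(i := a)) = r"
      "(r(i := t r), r i) \<in> ?R \<times> idx"
      "(case (r(i := t r), r i) of (r, a) \<Rightarrow> G r) = G (r(i := t r))"
      using i by (auto simp: t assignments_upd assignments_idx)
  next
    fix p assume "p \<in> ?R \<times> idx"
    then show "((case p of (r, a) \<Rightarrow> r(i := a))(i := t (case p of (r, a) \<Rightarrow> r(i := a))),
        (case p of (r, a) \<Rightarrow> r(i := a)) i) = p"
      "(case p of (r, a) \<Rightarrow> r(i := a)) \<in> assignments"
      using i by (auto simp: t assignments_upd fun_upd_idem)
  qed
  also have "\<dots> = (\<Sum>r\<in>?R. 8 * G r)"
    by (simp add: sum.cartesian_product[symmetric] idx_def)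
  also have "\<dots> = 8 * (\<Sum>r\<in>assignments. of_bool (r i = t r) * G r)"
    unfolding sum_distrib_left using finite_assignments
    by (intro sum.mono_neutral_cong_left) auto
  finally show ?thesis ..
qed

lemma eval_diagram_sub: "r \<in> assignments \<Longrightarrow> eval_diagram r (substitute i j f w) = eval_diagram (r(i
    := slot_index r j f)) w"
proof (induction w rule: eval_diagram.induct[of _ r])
  case (2 r m a b c d w)
  have "slot_index r (rename_label (eq_nat e i) e j) (rename_flag (eq_nat e i) g f) = slot_index
      (r(i := slot_index r j f)) e g" for e g
    using slot_index_val[OF 2(2), of g j f] by (auto simp: slot_index_def[of "r(i := slot_index r j
        f)"] slot_index_def[of r e])
  with 2 show ?case by (simp del: fun_upd_apply add: fun_upd_def[symmetric])
qed simp

lemma rename_label_if: "rename_label p a j = (if p then j else a)"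
  by (cases p) simp_all

text \<open>The function \<open>F\<close> of the evaluated word is arbitrary because the rule serves
  both for tensors and for the functional.\<close>

lemma contract_sound:
  fixes F :: "index_word \<Rightarrow> complex"
  shows "8 * (\<Sum>r\<in>assignments. metric (slot_index r i b) (slot_index r j c) * F (eval_diagram r w)) =
    (case contract i b j c w of None \<Rightarrow> 0 | Some (x, w') \<Rightarrow> of_int x * (\<Sum>r\<in>assignments. F
        (eval_diagram r w')))"
proof -
  have upd: "8 * (\<Sum>r\<in>assignments. metric (slot_index r i b) (slot_index r j c) * F (eval_diagram r
      w)) =
      (\<Sum>r\<in>assignments. F (eval_diagram r (substitute i j (b = c) w)))" if "internal i" "i \<noteq> j" for i
          j b c
    using sum_rho_upd[of i "\<lambda>r. slot_index r j (b = c)" "\<lambda>r. F (eval_diagram r w)"] that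
    by (simp add: metric_slot_index slot_index_idx eval_diagram_sub) (simp add: slot_index_def)
  show ?thesis
  proof (cases "i = j")
    case True
    have "metric (slot_index r j b) (slot_index r j c) = of_bool (b \<noteq> c)" if "r \<in> assignments" for r
      using assignments_idx[OF that, of j] by (auto simp: metric_def slot_index_def idx_def)
          presburger+
    with True show ?thesis
      by (cases "b = c") (simp_all add: contract_def)
  next
    case False
    consider "internal i" | "\<not> internal i" "internal j" | "\<not> internal i" "\<not> internal j" by blast
    then show ?thesis
    proof cases
      case 1
      with False upd[OF 1 False, of b c] show ?thesis by (simp add: contract_def)
    next
      case 2
      with False upd[OF 2(2), of i c b] show ?thesis
        by (simp add: contract_def metric_commute[of "slot_index _ i b"] eq_commute[of b c])
    next
      case 3
      let ?P = "(if i < 12 then i else 0) = (if j < 12 then j else 0) \<and> b \<noteq> c"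
      have "r i = slot_index r j (b = c) \<longleftrightarrow> ?P" if "r \<in> assignments" for r
        using 3 assignments_external[OF that 3(1)] assignments_external[OF that 3(2)]
        by (auto simp: slot_index_def internal_iff)
      then have "(\<Sum>r\<in>assignments. metric (slot_index r i b) (slot_index r j c) * F (eval_diagram r
          w)) =
          of_bool ?P * (\<Sum>r\<in>assignments. F (eval_diagram r w))"
        unfolding sum_distrib_left by (intro sum.cong) (simp_all add: metric_slot_index)
      with 3 False show ?thesis
        by (simp only: contract_def eq_nat_iff contract1.simps contract3.simps rename_label_if
            xor_iff) (cases ?P; simp only: simp_thms contract2.simps option.case prod.case
            of_bool_eq; simp)
    qed
  qed
qed

section \<open>Diagrams as tensors and the commutation rule\<close>

definition level :: complex where "level = -14/3"

abbreviation eqv (infix "\<approx>" 50) where "f \<approx> h \<equiv> vkeq so8 nform level f h"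

lemma sum_tens_apply: "(\<Sum>x\<in>S. f x :: tens) u = (\<Sum>x\<in>S. f x u)"
  by (induction S rule: infinite_finite_induct)
    (simp_all only: sum.infinite sum.empty sum.insert zero_fun_apply plus_fun_apply
        not_False_eq_True)

fun to_word :: "index_word \<Rightarrow> word" where
  "to_word [] = []" | "to_word ((m, a, b) # w) = (Jm a b, m) # to_word w"

lemma to_word_append [simp]: "to_word (u @ v) = to_word u @ to_word v"
  by (induction u rule: to_word.induct) simp_all

definition term_at :: "(nat \<Rightarrow> nat) \<Rightarrow> diagram \<Rightarrow> tens" where
  "term_at r w = mono (to_word (eval_diagram r w))"

text \<open>The factor \<open>24 = 8 * 3\<close> per letter absorbs the factor \<open>1/8\<close> of a contraction and the
  denominator 3 of the level.\<close>

definition diagram_tens :: "diagram \<Rightarrow> tens" where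
  "diagram_tens w = tsmul (24 ^ length w) (\<Sum>r\<in>assignments. term_at r w)"

fun lincomb_tens :: "lincomb \<Rightarrow> tens" where
  "lincomb_tens [] = 0" | "lincomb_tens ((c, w) # ps) = tsmul (of_int c) (diagram_tens w) +
      lincomb_tens ps"

lemma to_word_gwords: "r \<in> assignments \<Longrightarrow> to_word (eval_diagram r w) \<in> gwords so8"
  by (induction r w rule: eval_diagram.induct) (simp_all add: Jm_so8 slot_index_idx)

text \<open>A letter is linear in its matrix only modulo the relations, so the sign is extracted by
  one linearity relation with second coefficient 0.\<close>

lemma letter_antisym:
  assumes "a \<in> idx" "b \<in> idx" "u \<in> gwords so8" "v \<in> gwords so8"
  shows "mono (u @ (Jm b a, n) # v) \<approx> - mono (u @ (Jm a b, n) # v)"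
proof -
  have "Jm b a = madd (msmul (- 1) (Jm a b)) (msmul 0 (Jm a b))"
    by (simp add: fun_eq_iff madd_def msmul_def Jm_def)
  then show ?thesis
    using keq_linear[where g = so8 and X = "Jm a b" and Y = "Jm a b" and u = u and v = v
        and a = "- 1" and b = 0 and n = n and B = nform and k = level] assms by (simp add: Jm_so8)
qed

lemma keq_0I: "f \<approx> - f \<Longrightarrow> f \<approx> 0"
  using keq_smul[of so8 nform level "f" "- f" "1/2", THEN keq_add[OF keq_refl[of so8 nform level
      "tsmul (1/2) f"]]]
  by (simp only: tsmul_simps(3)[symmetric] tsmul_simps(10) add.right_inverse) simp

lemma letter_zero:
  assumes "a \<in> idx" "u \<in> gwords so8" "v \<in> gwords so8"
  shows "mono (u @ (Jm a a, n) # v) \<approx> 0"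
  using letter_antisym[of a a u v n] assms by (intro keq_0I)

lemma letter_swap:
  assumes "a \<in> idx" "b \<in> idx" "c \<in> idx" "d \<in> idx" "u \<in> gwords so8" "v \<in> gwords so8"
  shows "mono (u @ (Jm a b, m) # (Jm c d, n) # v) - mono (u @ (Jm c d, n) # (Jm a b, m) # v) \<approx>
    (tsmul (metric b c) (mono (u @ (Jm a d, m + n) # v))
      + tsmul (- metric a c) (mono (u @ (Jm b d, m + n) # v)))
    + (tsmul (- metric b d) (mono (u @ (Jm a c, m + n) # v))
      + tsmul (metric a d) (mono (u @ (Jm b c, m + n) # v)))
    + tsmul (if m + n = 0 then of_int m * (metric b c * metric a d - metric a c * metric b d) *
        level else 0)
        (mono (u @ v))"
proof -
  let ?X = "madd (msmul (metric b c) (Jm a d)) (msmul (- metric a c) (Jm b d))"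
  let ?Y = "madd (msmul (- metric b d) (Jm a c)) (msmul (metric a d) (Jm b c))"
  have XY: "?X \<in> so8" "?Y \<in> so8"
    using assms by (simp_all add: so8_lincomb Jm_so8)
  have "mono (u @ (mbr (Jm a b) (Jm c d), m + n) # v) \<approx>
      tsmul 1 (mono (u @ (?X, m + n) # v)) + tsmul 1 (mono (u @ (?Y, m + n) # v))"
    unfolding mbr_Jm[OF assms(1-4)] by (rule keq_linear[OF XY assms(5,6)])
  also have "\<dots> \<approx> tsmul 1 (tsmul (metric b c) (mono (u @ (Jm a d, m + n) # v))
      + tsmul (- metric a c) (mono (u @ (Jm b d, m + n) # v)))
    + tsmul 1 (tsmul (- metric b d) (mono (u @ (Jm a c, m + n) # v))
      + tsmul (metric a d) (mono (u @ (Jm b c, m + n) # v)))"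
    by (intro keq_add keq_smul keq_linear) (simp_all add: assms Jm_so8)
  finally have bracket: "mono (u @ (mbr (Jm a b) (Jm c d), m + n) # v) \<approx> \<dots>" .
  have "mono (u @ (Jm a b, m) # (Jm c d, n) # v) - mono (u @ (Jm c d, n) # (Jm a b, m) # v) \<approx>
    mono (u @ (mbr (Jm a b) (Jm c d), m + n) # v)
    + tsmul (if m + n = 0 then of_int m * (metric b c * metric a d - metric a c * metric b d) *
        level else 0)
        (mono (u @ v))"
    unfolding nform_Jm[OF assms(1-4), symmetric]
    by (rule keq_swap) (simp_all add: assms Jm_so8)
  from keq_trans[OF this keq_add[OF bracket keq_refl]] show ?thesis
    by (simp only: tsmul_simps(8))
qed

lemma contract_length: "contract i b j c w = Some (x, w') \<Longrightarrow> length w' = length w"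
proof -
  have "length (substitute i j f w) = length w" for i j f
    by (induction i j f w rule: substitute.induct) simp_all
  then show "contract i b j c w = Some (x, w') \<Longrightarrow> length w' = length w"
    unfolding contract_def
    by (cases "i = j"; cases "internal i"; cases "internal j"; cases "b = c")
      (auto elim: contract2.elims)
qed

lemma contract_sound_tens:
  fixes F :: "index_word \<Rightarrow> tens"
  shows "tsmul 8 (\<Sum>r\<in>assignments. tsmul (metric (slot_index r i b) (slot_index r j c)) (F
      (eval_diagram r w))) =
    (case contract i b j c w of None \<Rightarrow> 0 | Some (x, w') \<Rightarrow> tsmul (of_int x) (\<Sum>r\<in>assignments. F
        (eval_diagram r w')))"
proof
  fix u
  show "tsmul 8 (\<Sum>r\<in>assignments. tsmul (metric (slot_index r i b) (slot_index r j c)) (F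
      (eval_diagram r w))) u =
    (case contract i b j c w of None \<Rightarrow> 0 | Some (x, w') \<Rightarrow> tsmul (of_int x) (\<Sum>r\<in>assignments. F
        (eval_diagram r w'))) u"
    using contract_sound[of i b j c "\<lambda>x. F x u" w]
    by (simp add: tsmul_def sum_tens_apply zero_fun_apply split: option.split)
qed

lemma add_contraction_sound:
  "lincomb_tens (add_contraction k (contract i b j c w) acc) =
    tsmul (of_int k * 24 ^ length w) (tsmul 8 (\<Sum>r\<in>assignments. tsmul (metric (slot_index r i b)
        (slot_index r j c)) (term_at r w)))
    + lincomb_tens acc"
  using contract_sound_tens[of i b j c "\<lambda>x. mono (to_word x)" w]
  by (cases "contract i b j c w") (auto simp: term_at_def diagram_tens_def contract_length mult_ac)

lemma add_contraction2_sound: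
  "lincomb_tens (add_contraction2 k (contract i b j c (L m a d e f # w)) acc) =
    tsmul (of_int k * 64 * 24 ^ length w)
      (\<Sum>r\<in>assignments. tsmul (metric (slot_index r i b) (slot_index r j c) * metric (slot_index r a
          d) (slot_index r e f)) (term_at r w))
    + lincomb_tens acc"
proof -
  \<comment> \<open>This function reads a metric off the head letter and drops the letter, which
    turns a product of two metrics into one contraction with a different \<open>F\<close>.\<close>
  let ?F = "\<lambda>x. case x of [] \<Rightarrow> 0 | (m, p, q) # y \<Rightarrow> tsmul (metric p q) (mono (to_word y))"
  note * = contract_sound_tens[of i b j c ?F "L m a d e f # w", simplified]
  show ?thesis
  proof (cases "contract i b j c (L m a d e f # w)")
    case None
    have "tsmul 8 (\<Sum>r\<in>assignments. tsmul (metric (slot_index r i b) (slot_index r j c) * metric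
        (slot_index r a d) (slot_index r e f)) (term_at r w)) = 0"
      using * None by (simp only: option.case term_at_def[symmetric])
    from arg_cong[OF this, of "tsmul (1/8)"]
    have "(\<Sum>r\<in>assignments. tsmul (metric (slot_index r i b) (slot_index r j c) * metric (slot_index
        r a d) (slot_index r e f)) (term_at r w)) = 0"
      by simp
    then show ?thesis
      by (simp only: None add_contraction2.simps tsmul_simps(7) add_0)
  next
    case (Some p)
    obtain x w' where p: "p = (x, w')" by (cases p)
    have size_of: "length w' = Suc (length w)"
      using contract_length[of i b j c _ x w'] Some p by simp
    then obtain m' a' d' e' f' w'' where w': "w' = L m' a' d' e' f' # w''"
      by (metis length_Suc_conv letter_shape.exhaust)
    have "tsmul 8 (\<Sum>r\<in>assignments. tsmul (metric (slot_index r i b) (slot_index r j c) * metric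
        (slot_index r a d) (slot_index r e f)) (term_at r w))
      = tsmul (of_int x) (\<Sum>r\<in>assignments. tsmul (metric (slot_index r a' d') (slot_index r e' f'))
          (term_at r w''))"
      using * Some by (simp add: p w' term_at_def[symmetric])
    from arg_cong[OF this, of "tsmul (of_int k * 8 * 24 ^ length w)"]
    have "tsmul (of_int k * 64 * 24 ^ length w)
        (\<Sum>r\<in>assignments. tsmul (metric (slot_index r i b) (slot_index r j c) * metric (slot_index r
            a d) (slot_index r e f)) (term_at r w))
      = tsmul (of_int (k * x) * 24 ^ length w'') (tsmul 8 (\<Sum>r\<in>assignments. tsmul (metric (slot_index
          r a' d') (slot_index r e' f')) (term_at r w'')))"
      using size_of by (simp add: w' mult_ac)
    then show ?thesis
      by (simp only: Some p w' add_contraction2.simps add_contraction_sound)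
  qed
qed

text \<open>Here 2688 = 42 * 64, so the factor is 24^2 times the level -14/3.\<close>

lemma central_sound:
  "lincomb_tens (central p c i b j d k e l f w) =
    tsmul (if p then - 2688 * of_int c * 24 ^ length w else 0)
      (\<Sum>r\<in>assignments. tsmul (metric (slot_index r j d) (slot_index r k e) * metric (slot_index r i
          b) (slot_index r l f)
        - metric (slot_index r i b) (slot_index r k e) * metric (slot_index r j d) (slot_index r l
            f)) (term_at r w))"
proof (cases p)
  case True
  have "lincomb_tens (central True c i b j d k e l f w) =
    tsmul (of_int (- 42 * c) * 64 * 24 ^ length w)
      (\<Sum>r\<in>assignments. tsmul (metric (slot_index r j d) (slot_index r k e) * metric (slot_index r i
          b) (slot_index r l f)) (term_at r w))
    + (tsmul (of_int (42 * c) * 64 * 24 ^ length w)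
      (\<Sum>r\<in>assignments. tsmul (metric (slot_index r i b) (slot_index r k e) * metric (slot_index r j
          d) (slot_index r l f)) (term_at r w)) + 0)"
    by (simp only: central.simps add_contraction2_sound lincomb_tens.simps)
  with True show ?thesis
    by (simp add: sum_subtractf)
qed simp

lemma swap_sound:
  assumes r: "r \<in> assignments"
  shows "term_at r (u @ L m i b j d # L n k e l f # v) - term_at r (u @ L n k e l f # L m i b j d #
      v) \<approx>
    (tsmul (metric (slot_index r j d) (slot_index r k e)) (term_at r (u @ L (m + n) i b l f # v))
      + tsmul (- metric (slot_index r i b) (slot_index r k e)) (term_at r (u @ L (m + n) j d l f #
          v)))
    + (tsmul (- metric (slot_index r j d) (slot_index r l f)) (term_at r (u @ L (m + n) i b k e #
        v))
      + tsmul (metric (slot_index r i b) (slot_index r l f)) (term_at r (u @ L (m + n) j d k e #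
          v)))
    + tsmul (if m + n = 0 then of_int m * (metric (slot_index r j d) (slot_index r k e) * metric
        (slot_index r i b) (slot_index r l f)
        - metric (slot_index r i b) (slot_index r k e) * metric (slot_index r j d) (slot_index r l
            f)) * level else 0) (term_at r (u @ v))"
  unfolding term_at_def eval_diagram_append eval_diagram.simps to_word_append to_word.simps
  by (rule letter_swap) (simp_all add: r slot_index_idx to_word_gwords)

lemma combine:
  assumes "a * 8 = C" "b * 8 = - C" "q = C * z"
  shows "tsmul C (A1 - A2 - A3 + A4 + tsmul z A5) = tsmul a (tsmul 8 A1)
    + (tsmul b (tsmul 8 A2) + (tsmul b (tsmul 8 A3) + (tsmul a (tsmul 8 A4) + tsmul q A5)))"
  unfolding tsmul_simps(5) assms by (simp add: algebra_simps)

lemma bracket_sound: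
  "tsmul (of_int c) (diagram_tens (rev u @ k # l # v) - diagram_tens (rev u @ l # k # v)) \<approx>
      lincomb_tens (bracket c u k l v)"
proof -
  obtain m i b j d where k: "k = L m i b j d" by (cases k)
  obtain n i' b' j' d' where l: "l = L n i' b' j' d'" by (cases l)
  let ?N = "length u + length v"
  let ?g1 = "\<lambda>r. metric (slot_index r j d) (slot_index r i' b')" and ?g2 = "\<lambda>r. metric (slot_index r
      i b) (slot_index r i' b')"
  let ?g3 = "\<lambda>r. metric (slot_index r j d) (slot_index r j' d')" and ?g4 = "\<lambda>r. metric (slot_index r
      i b) (slot_index r j' d')"
  let ?M1 = "\<lambda>r. term_at r (rev u @ L (m + n) i b j' d' # v)" and ?M2 = "\<lambda>r. term_at r (rev u @ L (m
      + n) j d j' d' # v)"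
  let ?M3 = "\<lambda>r. term_at r (rev u @ L (m + n) i b i' b' # v)" and ?M4 = "\<lambda>r. term_at r (rev u @ L (m
      + n) j d i' b' # v)"
  let ?Q = "\<lambda>r. term_at r (rev u @ v)"
  let ?q = "\<lambda>r. ?g1 r * ?g4 r - ?g2 r * ?g3 r"
  let ?z = "if m + n = 0 then of_int m * level else (0 :: complex)"
  let ?C = "of_int c * 24 ^ (?N + 2) :: complex"
  have "tsmul (of_int c) (diagram_tens (rev u @ k # l # v) - diagram_tens (rev u @ l # k # v)) =
      tsmul ?C (\<Sum>r\<in>assignments. term_at r (rev u @ k # l # v) - term_at r (rev u @ l # k # v))"
    by (simp add: diagram_tens_def sum_subtractf)
  moreover have "tsmul ?C (\<Sum>r\<in>assignments. term_at r (rev u @ k # l # v) - term_at r (rev u @ l # k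
      # v)) \<approx> tsmul ?C (\<Sum>r\<in>assignments.
      (tsmul (?g1 r) (?M1 r) + tsmul (- ?g2 r) (?M2 r)) + (tsmul (- ?g3 r) (?M3 r) + tsmul (?g4 r)
          (?M4 r))
      + tsmul (if m + n = 0 then of_int m * ?q r * level else 0) (?Q r))"
    unfolding k l by (intro keq_smul keq_sum swap_sound)
  moreover have sum_eq: "(\<Sum>r\<in>assignments.
      (tsmul (?g1 r) (?M1 r) + tsmul (- ?g2 r) (?M2 r)) + (tsmul (- ?g3 r) (?M3 r) + tsmul (?g4 r)
          (?M4 r))
      + tsmul (if m + n = 0 then of_int m * ?q r * level else 0) (?Q r)) =
      (\<Sum>r\<in>assignments. tsmul (?g1 r) (?M1 r)) - (\<Sum>r\<in>assignments. tsmul (?g2 r) (?M2 r))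
      - (\<Sum>r\<in>assignments. tsmul (?g3 r) (?M3 r)) + (\<Sum>r\<in>assignments. tsmul (?g4 r) (?M4 r))
      + tsmul ?z (\<Sum>r\<in>assignments. tsmul (?q r) (?Q r))"
  proof -
    have "tsmul (if m + n = 0 then of_int m * ?q r * level else 0) (?Q r) = tsmul ?z (tsmul (?q r)
        (?Q r))" for r
      by (simp only: tsmul_simps(5)) (simp add: mult_ac)
    then show ?thesis
      by (simp only: sum.distrib tsmul_simps(9) sum_negf tsmul_sum) (simp add: algebra_simps)
  qed
  moreover have "tsmul ?C ((\<Sum>r\<in>assignments. tsmul (?g1 r) (?M1 r)) - (\<Sum>r\<in>assignments. tsmul (?g2 r)
      (?M2 r))
      - (\<Sum>r\<in>assignments. tsmul (?g3 r) (?M3 r)) + (\<Sum>r\<in>assignments. tsmul (?g4 r) (?M4 r))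
      + tsmul ?z (\<Sum>r\<in>assignments. tsmul (?q r) (?Q r))) = lincomb_tens (bracket c u k l v)"
  proof -
    have "lincomb_tens (bracket c u k l v) =
      tsmul (of_int (3 * c) * 24 ^ (?N + 1)) (tsmul 8 (\<Sum>r\<in>assignments. tsmul (?g1 r) (?M1 r)))
      + (tsmul (of_int (- 3 * c) * 24 ^ (?N + 1)) (tsmul 8 (\<Sum>r\<in>assignments. tsmul (?g2 r) (?M2 r)))
      + (tsmul (of_int (- 3 * c) * 24 ^ (?N + 1)) (tsmul 8 (\<Sum>r\<in>assignments. tsmul (?g3 r) (?M3 r)))
      + (tsmul (of_int (3 * c) * 24 ^ (?N + 1)) (tsmul 8 (\<Sum>r\<in>assignments. tsmul (?g4 r) (?M4 r)))
      + tsmul (if m + n = 0 then - 2688 * of_int (m * c) * 24 ^ ?N else 0) (\<Sum>r\<in>assignments. tsmul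
          (?q r) (?Q r)))))"
      unfolding k l bracket.simps add_contraction_sound central_sound rev_append_eq by simp
    then show ?thesis
      by (simp only:, intro combine) (simp_all add: level_def)
  qed
  ultimately show ?thesis by (simp only:)
qed

lemma swap_terms_sound: "tsmul (of_int c) (diagram_tens (rev u @ k # l # v)) \<approx> lincomb_tens
    (swap_terms c u k l v)"
  using keq_add[OF bracket_sound[of c u k l v] keq_refl[of so8 nform level "tsmul (of_int c)
      (diagram_tens (rev u @ l # k # v))"]]
  by (simp add: swap_terms_def add.commute)

section \<open>Renaming of summation labels and canonical forms\<close>

definition new_name :: "renaming \<Rightarrow> nat \<Rightarrow> nat \<times> bool" where
  "new_name s i = (case map_of s i of Some x \<Rightarrow> x | None \<Rightarrow> (i, False))"

definition known :: "renaming \<Rightarrow> nat \<Rightarrow> bool" where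
  "known s i \<longleftrightarrow> i \<in> fst ` set s \<or> \<not> internal i"

lemma look_up_eq: "look_up i s = (if known s i then Some (new_name s i) else None)"
  by (induction i s rule: look_up.induct) (auto simp: known_def new_name_def elim!: look_up0.elims)

fun apply_renaming :: "renaming \<Rightarrow> diagram \<Rightarrow> diagram" where
  "apply_renaming s [] = []"
| "apply_renaming s (L m i b j d # w) = L m (fst (new_name s i)) (b \<noteq> snd (new_name s i)) (fst
    (new_name s j)) (d \<noteq> snd (new_name s j)) # apply_renaming s w"

lemma apply_renaming_append [simp]: "apply_renaming s (u @ v) = apply_renaming s u @ apply_renaming
    s v"
  by (induction s u rule: apply_renaming.induct) simp_all

fun labels :: "diagram \<Rightarrow> nat set" where
  "labels [] = {}" | "labels (L m i b j d # w) = {i, j} \<union> labels w"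

lemma labels_append [simp]: "labels (u @ v) = labels u \<union> labels v"
  by (induction u rule: labels.induct) auto

lemma apply_renaming_cong: "(\<And>i. i \<in> labels w \<Longrightarrow> new_name s i = new_name s' i) \<Longrightarrow> apply_renaming s w =
    apply_renaming s' w"
  by (induction w rule: labels.induct) auto

definition valid_renaming :: "renaming \<Rightarrow> nat \<Rightarrow> bool" where
  "valid_renaming s n \<longleftrightarrow> distinct (map fst s) \<and> (\<forall>i\<in>fst ` set s. internal i) \<and>
     distinct (map (fst \<circ> snd) s) \<and> (fst \<circ> snd) ` set s = {4..<n} \<and> n = 4 + length s"

text \<open>There are only eight internal labels to be renamed, so the fresh labels 4, 5, ... never
  leave the internal range.\<close>

lemma valid_renaming_bound:
  assumes "valid_renaming s n" shows "n \<le> 12"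
proof -
  have "length s = card (fst ` set s)"
    using assms distinct_card[of "map fst s"] by (simp add: valid_renaming_def)
  also have "\<dots> \<le> card {4..<12::nat}"
    using assms by (intro card_mono) (auto simp: valid_renaming_def internal_iff)
  finally show ?thesis using assms by (simp add: valid_renaming_def)
qed

lemma valid_renaming_Cons: "valid_renaming s n \<Longrightarrow> internal i \<Longrightarrow> \<not> known s i \<Longrightarrow> valid_renaming ((i, n,
    b) # s) (Suc n)"
  by (auto simp: valid_renaming_def known_def atLeastLessThanSuc image_iff)

lemma new_name_mem:
  assumes "k \<in> fst ` set s" shows "(k, new_name s k) \<in> set s"
proof (cases "map_of s k")
  case None
  with assms show ?thesis by (simp add: map_of_eq_None_iff)
next
  case (Some x)
  then show ?thesis using map_of_SomeD[OF Some] by (simp add: new_name_def)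
qed

lemma new_name_internal:
  assumes "valid_renaming s n" "k \<in> fst ` set s" shows "internal (fst (new_name s k))"
proof -
  have "fst (new_name s k) \<in> (fst \<circ> snd) ` set s"
    using new_name_mem[OF assms(2)] by force
  then show ?thesis
    using assms(1) valid_renaming_bound[OF assms(1)] by (auto simp: valid_renaming_def internal_iff)
qed

lemma new_name_external:
  assumes "k \<notin> fst ` set s" shows "new_name s k = (k, False)"
proof -
  have "map_of s k = None" using assms by (simp add: map_of_eq_None_iff)
  then show ?thesis by (simp add: new_name_def)
qed

lemma new_name_inj:
  assumes g: "valid_renaming s n" and "known s i" "known s j" "fst (new_name s i) = fst (new_name s
      j)"
  shows "i = j"
proof -
  have inj: "k = k'" if "(k, x, b) \<in> set s" "(k', x, b') \<in> set s" for k k' x b b'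
    using g that by (auto simp: valid_renaming_def distinct_map dest!: inj_onD[of _ _ "(k, x, b)"
        "(k', x, b')"])
  show ?thesis
  proof (cases "i \<in> fst ` set s"; cases "j \<in> fst ` set s")
    assume "i \<in> fst ` set s" "j \<in> fst ` set s"
    then show ?thesis
      using new_name_mem[of i s] new_name_mem[of j s] assms(4)
      by (cases "new_name s i"; cases "new_name s j") (auto intro: inj)
  next
    assume "i \<in> fst ` set s" "j \<notin> fst ` set s"
    then show ?thesis
      using new_name_internal[OF g, of i] new_name_external[of j s] assms(3,4) by (simp add:
          known_def)
  next
    assume "i \<notin> fst ` set s" "j \<in> fst ` set s"
    then show ?thesis
      using new_name_internal[OF g, of j] new_name_external[of i s] assms(2,4) by (simp add:
          known_def)
  next
    assume "i \<notin> fst ` set s" "j \<notin> fst ` set s"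
    then show ?thesis
      using new_name_external[of i s] new_name_external[of j s] assms(4) by simp
  qed
qed

lemma eval_diagram_cong: "(\<And>i. i \<in> labels w \<Longrightarrow> r i = r' i) \<Longrightarrow> eval_diagram r w = eval_diagram r' w"
  by (induction w rule: labels.induct) (auto simp: slot_index_def)

lemma dual_dual: "r \<in> assignments \<Longrightarrow> 9 - (9 - r i) = r i"
  using assignments_idx[of r i] by (simp add: idx_def)

lemma finite_internal: "finite (Collect internal)"
  by (rule finite_subset[of _ "{4..<12}"]) (auto simp: internal_iff)

text \<open>Permuting the summation labels and dualising some of them permutes the
  assignments.\<close>

lemma sum_rho_bij:
  assumes pi: "bij_betw p (Collect internal) (Collect internal)"
  shows "(\<Sum>r\<in>assignments. G (\<lambda>i. if internal i then slot_index r (p i) (e i) else r i)) =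
      (\<Sum>r\<in>assignments. G r :: tens)"
proof -
  let ?q = "the_inv_into (Collect internal) p"
  have q: "internal (p i)" "?q (p i) = i" "internal (?q i)" "p (?q i) = i" if "internal i" for i
    using that pi by (auto simp: bij_betw_def the_inv_into_f_f f_the_inv_into_f
        intro: the_inv_into_into[THEN CollectD])
  have slot_index_twice: "slot_index r' i b = r i" if "r \<in> assignments" "r' i = slot_index r i b"
      for r r' i b
    using assignments_idx[OF that(1), of i] that(2) by (auto simp: slot_index_def idx_def)
  show ?thesis
  proof (rule sum.reindex_bij_witness[where
        j = "\<lambda>r i. if internal i then slot_index r (p i) (e i) else r i" and
        i = "\<lambda>r i. if internal i then slot_index r (?q i) (e (?q i)) else r i"])
    fix r assume r: "r \<in> assignments"
    have in_assignments: "(\<lambda>i. if internal i then slot_index r (h i) (c i) else r i) \<in> assignments"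
        for h c
      using slot_index_idx[OF r] assignments_external[OF r] by (auto simp: assignments_def
          label_range_def)
    show "(\<lambda>i. if internal i then slot_index r (p i) (e i) else r i) \<in> assignments"
      "(\<lambda>i. if internal i then slot_index r (?q i) (e (?q i)) else r i) \<in> assignments"
      by (rule in_assignments)+
    show "(\<lambda>i. if internal i then slot_index (\<lambda>i. if internal i then slot_index r (p i) (e i) else r
        i) (?q i) (e (?q i))
        else if internal i then slot_index r (p i) (e i) else r i) = r"
      using r by (auto simp: fun_eq_iff q slot_index_def dual_dual)
    show "(\<lambda>i. if internal i then slot_index (\<lambda>i. if internal i then slot_index r (?q i) (e (?q i))
        else r i) (p i) (e i)
        else if internal i then slot_index r (?q i) (e (?q i)) else r i) = r"
      using r by (auto simp: fun_eq_iff q slot_index_def dual_dual)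
  qed simp
qed

lemma sum_apply_renaming:
  assumes g: "valid_renaming s n" and w: "\<And>i. i \<in> labels w \<Longrightarrow> known s i"
  shows "(\<Sum>r\<in>assignments. term_at r (apply_renaming s w)) = (\<Sum>r\<in>assignments. term_at r w)"
proof -
  let ?I = "Collect internal" and ?A = "fst ` set s" and ?f = "\<lambda>i. fst (new_name s i)"
  have fin: "finite ?I" by (rule finite_internal)
  have A: "?A \<subseteq> ?I" using g by (auto simp: valid_renaming_def)
  have f: "?f i \<in> ?I" if "i \<in> ?A" for i
    using new_name_internal[OF g that] by simp
  have inj: "inj_on ?f ?A"
    using new_name_inj[OF g] by (auto simp: inj_on_def known_def)
  have "card (?I - ?A) = card (?I - ?f ` ?A)"
    using card_Diff_subset[OF finite_subset[OF A fin] A] card_image[OF inj]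
      card_Diff_subset[of "?f ` ?A" ?I] finite_subset[OF A fin] image_subsetI[of ?A ?f ?I, OF f]
    by simp
  \<comment> \<open>The renaming is an injection on the labels met so far. Its complements in domain
    and range have equal size, so an arbitrary matching extends it to a permutation of the summation
    labels.\<close>
  then obtain h where h: "bij_betw h (?I - ?A) (?I - ?f ` ?A)"
    using fin finite_same_card_bij[of "?I - ?A" "?I - ?f ` ?A"] by auto
  let ?p = "\<lambda>i. if i \<in> ?A then ?f i else h i"
  have "bij_betw ?p (?A \<union> (?I - ?A)) (?f ` ?A \<union> (?I - ?f ` ?A))"
  proof (rule bij_betw_combine)
    show "bij_betw ?p ?A (?f ` ?A)"
      using inj by (auto simp: bij_betw_def inj_on_def)
    show "bij_betw ?p (?I - ?A) (?I - ?f ` ?A)"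
      using h by (subst bij_betw_cong[where g = h]) auto
  qed auto
  moreover have "?A \<union> (?I - ?A) = ?I" "?f ` ?A \<union> (?I - ?f ` ?A) = ?I"
    using A f by auto
  ultimately have p: "bij_betw ?p ?I ?I" by simp
  have new_name_ext: "new_name s i = (i, False)" if "\<not> internal i" for i
    using that A by (intro new_name_external) auto
  have eval_diagram: "eval_diagram r (apply_renaming s w) = eval_diagram (\<lambda>i. if internal i then
      slot_index r (?p i) (snd (new_name s i)) else r i) w"
    if "r \<in> assignments" for r
    using w
  proof (induction w rule: labels.induct)
    case (2 m i b j d w)
    have "slot_index r (fst (new_name s k)) (c \<noteq> snd (new_name s k)) =
      slot_index (\<lambda>i. if internal i then slot_index r (?p i) (snd (new_name s i)) else r i) k c" if
          "known s k" for k c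
    proof (cases "internal k")
      case True
      with that have "k \<in> ?A" by (simp add: known_def)
      with True show ?thesis
        using slot_index_val[OF \<open>r \<in> assignments\<close>, of c "fst (new_name s k)" "snd (new_name s k)"]
        by (cases c) (simp_all add: slot_index_def[of "\<lambda>i. if internal i then _ i else _ i"])
    qed (simp add: new_name_ext slot_index_def)
    with 2 show ?case by simp
  qed simp
  show ?thesis
    using sum_rho_bij[OF p, of "\<lambda>r. term_at r w" "\<lambda>i. snd (new_name s i)"] unfolding term_at_def
    by (simp add: eval_diagram cong: sum.cong)
qed

lemma term_at_flip: "r \<in> assignments \<Longrightarrow> term_at r (u @ L m j d i b # v) \<approx> - term_at r (u @ L m i b j
    d # v)"
  unfolding term_at_def eval_diagram_append eval_diagram.simps to_word_append to_word.simps
  by (rule letter_antisym) (simp_all add: slot_index_idx to_word_gwords)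

lemma diagram_tens_zero_eq: "diagram_tens (u @ L m i b i b # v) \<approx> 0"
proof -
  have "(\<Sum>r\<in>assignments. term_at r (u @ L m i b i b # v)) \<approx> (\<Sum>r\<in>assignments. 0)"
    unfolding term_at_def eval_diagram_append eval_diagram.simps to_word_append to_word.simps
    by (intro keq_sum letter_zero) (simp_all add: slot_index_idx to_word_gwords)
  from keq_smul[OF this] show ?thesis by (simp only: diagram_tens_def sum.neutral_const
      tsmul_simps(7))
qed

text \<open>Replacing the index by its dual exchanges the two slots and affects no other letter, so
  by antisymmetry the sum is its own negative.\<close>

lemma diagram_tens_zero_loop:
  assumes i: "internal i" "i \<notin> labels u" "i \<notin> labels v"
  shows "diagram_tens (u @ L m i b i d # v) \<approx> 0"
proof (cases "b = d")
  case False
  have "(\<Sum>r\<in>assignments. term_at r (u @ L m i b i d # v)) = (\<Sum>r\<in>assignments. term_at r (u @ L m i d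
      i b # v))"
  proof (rule sum.reindex_bij_witness[where i = "\<lambda>r. r(i := 9 - r i)" and j = "\<lambda>r. r(i := 9 - r
      i)"])
    fix r assume r: "r \<in> assignments"
    show "(r(i := 9 - r i))(i := 9 - (r(i := 9 - r i)) i) = r"
      "(r(i := 9 - r i))(i := 9 - (r(i := 9 - r i)) i) = r"
      using assignments_idx[OF r, of i] by (simp_all add: idx_def)
    show "r(i := 9 - r i) \<in> assignments" "r(i := 9 - r i) \<in> assignments"
      using assignments_upd[OF r i(1), of "9 - r i"] assignments_idx[OF r, of i] by simp_all
    have "eval_diagram (r(i := 9 - r i)) w = eval_diagram r w" if "i \<notin> labels w" for w
      using that by (intro eval_diagram_cong) auto
    then show "term_at (r(i := 9 - r i)) (u @ L m i d i b # v) = term_at r (u @ L m i b i d # v)"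
      using i False assignments_idx[OF r, of i] by (auto simp: term_at_def slot_index_def idx_def)
  qed
  moreover have "(\<Sum>r\<in>assignments. term_at r (u @ L m i d i b # v)) \<approx> (\<Sum>r\<in>assignments. - term_at r (u
      @ L m i b i d # v))"
    by (intro keq_sum term_at_flip)
  ultimately have "(\<Sum>r\<in>assignments. term_at r (u @ L m i b i d # v)) \<approx> 0"
    by (intro keq_0I) (simp only: sum_negf)
  from keq_smul[OF this] show ?thesis by (simp only: diagram_tens_def tsmul_simps(7))
next
  case True
  then show ?thesis using diagram_tens_zero_eq by (simp only:)
qed

definition sign :: "bool \<Rightarrow> complex" where "sign b = (if b then 1 else - 1)"

text \<open>The output agrees, up to sign, with the renamed prefix for each assignment separately,
  since so far only slots were flipped. The renaming itself is undone by reindexing the sum once the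
  whole diagram is read; until then the suffix \<open>v\<close> is arbitrary.\<close>

definition canon_inv :: "diagram \<Rightarrow> nat \<Rightarrow> renaming \<Rightarrow> bool \<Rightarrow> diagram \<Rightarrow> bool" where
  "canon_inv p n s sg u \<longleftrightarrow> valid_renaming s n \<and> (\<forall>i\<in>labels p. known s i) \<and> length u = length p \<and>
     (\<forall>r\<in>assignments. \<forall>v. term_at r (rev u @ v) \<approx> tsmul (sign sg) (term_at r (apply_renaming s p @
         v)))"

lemma canon_inv_extend:
  assumes inv: "canon_inv p n s sg u"
    and s': "valid_renaming s' n'" "\<And>i. known s i \<Longrightarrow> known s' i \<and> new_name s' i = new_name s i"
        "known s' i" "known s' j"
    and new_name: "new_name s' i = (i', f)" "new_name s' j = (j', g)"
  shows "canon_inv (p @ [L m i b j d]) n' s' sg (L m i' (b \<noteq> f) j' (d \<noteq> g) # u)"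
    and "canon_inv (p @ [L m i b j d]) n' s' (\<not> sg) (L m j' (d \<noteq> g) i' (b \<noteq> f) # u)"
proof -
  have apply_renaming: "apply_renaming s' p = apply_renaming s p"
    using inv s'(2) by (intro apply_renaming_cong) (auto simp: canon_inv_def)
  have *: "term_at r (rev u @ v) \<approx> tsmul (sign sg) (term_at r (apply_renaming s p @ v))" if "r \<in>
      assignments" for r v
    using inv that by (simp add: canon_inv_def)
  have labels: "\<forall>i\<in>labels (p @ [L m i b j d]). known s' i" "length u = length p"
    using inv s' by (auto simp: canon_inv_def)
  show "canon_inv (p @ [L m i b j d]) n' s' sg (L m i' (b \<noteq> f) j' (d \<noteq> g) # u)"
    unfolding canon_inv_def using s'(1) labels *[of _ "L m i' (b \<noteq> f) j' (d \<noteq> g) # _"]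
    by (simp add: apply_renaming new_name)
  have "term_at r (rev u @ L m j' (d \<noteq> g) i' (b \<noteq> f) # v) \<approx>
      tsmul (sign (\<not> sg)) (term_at r (apply_renaming s p @ L m i' (b \<noteq> f) j' (d \<noteq> g) # v))" if r: "r
          \<in> assignments" for r v
  proof -
    note *[OF r, of "L m j' (d \<noteq> g) i' (b \<noteq> f) # v"]
    also have "tsmul (sign sg) (term_at r (apply_renaming s p @ L m j' (d \<noteq> g) i' (b \<noteq> f) # v)) \<approx>
        tsmul (sign sg) (- term_at r (apply_renaming s p @ L m i' (b \<noteq> f) j' (d \<noteq> g) # v))"
      by (intro keq_smul term_at_flip r)
    finally show ?thesis by (cases sg) (simp_all add: sign_def)
  qed
  then show "canon_inv (p @ [L m i b j d]) n' s' (\<not> sg) (L m j' (d \<noteq> g) i' (b \<noteq> f) # u)"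
    unfolding canon_inv_def using s'(1) labels by (simp add: apply_renaming new_name)
qed

lemma new_name_Cons: "new_name ((i, x) # s) j = (if i = j then x else new_name s j)"
  by (simp add: new_name_def)

lemma known_Cons: "known ((i, x) # s) j \<longleftrightarrow> i = j \<or> known s j"
  by (auto simp: known_def)

lemma first_occ_EQ: "first_occ i j w = EQ \<Longrightarrow> i \<notin> labels w"
  by (induction i j w rule: first_occ.induct) (auto split: if_splits)

lemma canon1_sound:
  assumes inv: "canon_inv p n s sg u"
  shows "case canon1 (look_up i s) (look_up j s) n s sg u m i b j d w of
      None \<Rightarrow> diagram_tens (p @ L m i b j d # w) \<approx> 0
    | Some (n', s', sg', u') \<Rightarrow> canon_inv (p @ [L m i b j d]) n' s' sg' u'"
proof -
  have g: "valid_renaming s n" using inv by (simp add: canon_inv_def)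
  have new: "valid_renaming ((k, n, c) # s) (Suc n)" if "\<not> known s k" for k c
    using that g by (intro valid_renaming_Cons) (auto simp: known_def)
  have new_known: "known ((k, n, c) # s) i \<and> new_name ((k, n, c) # s) i = new_name s i"
    if "\<not> known s k" "known s i" for k c i
    using that by (auto simp: known_Cons new_name_Cons)
  have new2: "valid_renaming ((l, Suc n, c') # (k, n, c) # s) (Suc (Suc n))"
    if "\<not> known s k" "\<not> known s l" "k \<noteq> l" for k c l c'
    using that new[OF that(1), of c] by (rule_tac valid_renaming_Cons) (auto simp: known_def)
  have new2_known: "known ((l, Suc n, c') # (k, n, c) # s) i
      \<and> new_name ((l, Suc n, c') # (k, n, c) # s) i = new_name s i"
    if "\<not> known s k" "\<not> known s l" "known s i" for k c l c' i
    using that by (auto simp: known_Cons new_name_Cons)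
  obtain i' f where i': "new_name s i = (i', f)" by (cases "new_name s i")
  obtain j' h where j': "new_name s j = (j', h)" by (cases "new_name s j")
  consider "known s i" "known s j" | "known s i" "\<not> known s j" | "\<not> known s i" "known s j"
    | "\<not> known s i" "\<not> known s j" "i = j" | "\<not> known s i" "\<not> known s j" "i \<noteq> j"
    by blast
  then show ?thesis
  proof cases
    case 1
    note ext = canon_inv_extend[OF inv g _ 1 i' j', of m b d]
    show ?thesis
    proof (cases "cmp_nat i' j'")
      case EQ
      then have "i = j" using new_name_inj[OF g 1] i' j' by (simp add: cmp_nat_EQ)
      with i' j' have h: "h = f" "j' = i'" by auto
      show ?thesis
        using 1 EQ ext diagram_tens_zero_eq[of p m i b w] \<open>i = j\<close>
        by (cases b; cases d; cases f) (simp_all add: look_up_eq i' j' h)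
    qed (use 1 ext in \<open>simp_all add: look_up_eq i' j'\<close>)
  next
    case 2
    then show ?thesis
      using canon_inv_extend(1)[OF inv new[OF 2(2), of d] new_known[OF 2(2)], of i j i' f n d m b d]
          i'
      by (cases "i = j") (simp_all add: look_up_eq known_Cons new_name_Cons)
  next
    case 3
    then show ?thesis
      using canon_inv_extend(2)[OF inv new[OF 3(1), of b] new_known[OF 3(1)], of i j n b j' h m b d]
          j'
      by (cases "i = j") (simp_all add: look_up_eq known_Cons new_name_Cons)
  next
    case 4
    have int: "internal i" "i \<notin> labels p"
      using 4 inv by (auto simp: known_def canon_inv_def)
    show ?thesis
      using 4 canon_inv_extend(1)[OF inv new[OF 4(1), of b] new_known[OF 4(1)], of i i n b n b m b
          d]
        diagram_tens_zero_loop[OF int first_occ_EQ, of i w m b d]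
      by (cases "first_occ i j w") (simp_all add: look_up_eq known_Cons new_name_Cons)
  next
    case 5
    show ?thesis
      using 5 canon_inv_extend(1)[OF inv new2[OF 5, of d b] new2_known[OF 5(1,2)], of i j n b "Suc
          n" d m b d]
        canon_inv_extend(2)[OF inv new2[OF 5(2,1) 5(3)[symmetric], of b d]
          new2_known[OF 5(2,1)], of i j "Suc n" b n d m b d]
      by (cases "first_occ i j w") (simp_all add: look_up_eq known_Cons new_name_Cons)
  qed
qed

lemma canon_loop_sound:
  "canon_inv p n s sg u \<Longrightarrow> case canon_loop (Some (n, s, sg, u)) w of
      None \<Rightarrow> diagram_tens (p @ w) \<approx> 0
    | Some (sg', w') \<Rightarrow> diagram_tens (p @ w) \<approx> tsmul (sign sg') (diagram_tens w')"
proof (induction w arbitrary: p n s sg u)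
  case Nil
  have "(\<Sum>r\<in>assignments. term_at r (rev u @ [])) \<approx> (\<Sum>r\<in>assignments. tsmul (sign sg) (term_at r
      (apply_renaming s p @ [])))"
    using Nil by (intro keq_sum) (simp only: canon_inv_def)
  also have "\<dots> = tsmul (sign sg) (\<Sum>r\<in>assignments. term_at r p)"
    using sum_apply_renaming[of s n p] Nil by (simp add: canon_inv_def tsmul_sum[symmetric])
  finally have "tsmul (sign sg * 24 ^ length p) (\<Sum>r\<in>assignments. term_at r (rev u)) \<approx>
      tsmul (sign sg * 24 ^ length p) (tsmul (sign sg) (\<Sum>r\<in>assignments. term_at r p))"
    by (intro keq_smul) (simp only: append_Nil2)
  then have "tsmul (sign sg) (diagram_tens (rev u)) \<approx> diagram_tens p"
    using Nil by (simp add: diagram_tens_def canon_inv_def sign_def split: if_splits)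
  then show ?case by (simp add: keq_sym)
next
  case (Cons l w)
  obtain m i b j d where l: "l = L m i b j d" by (cases l)
  show ?case
  proof (cases "canon1 (look_up i s) (look_up j s) n s sg u m i b j d w")
    case None
    with canon1_sound[OF Cons.prems, of m i b j d w] show ?thesis by (simp add: l)
  next
    case (Some st)
    obtain n' s' sg' u' where st: "st = (n', s', sg', u')" by (cases st)
    have "canon_inv (p @ [L m i b j d]) n' s' sg' u'"
      using canon1_sound[OF Cons.prems, of m i b j d w] Some by (simp add: st)
    from Cons.IH[OF this] show ?thesis
      by (simp only: l Some st canon_loop.simps append_assoc append_Cons append_Nil)
  qed
qed

lemma canonical_sound:
  "case canonical w of None \<Rightarrow> diagram_tens w \<approx> 0 | Some (sg, w') \<Rightarrow> diagram_tens w \<approx> tsmul (sign sg)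
      (diagram_tens w')"
proof -
  have "canon_inv [] (Suc (Suc (Suc (Suc 0)))) [] True []"
    by (simp add: canon_inv_def valid_renaming_def sign_def)
  from canon_loop_sound[OF this, of w] show ?thesis
    by (simp only: canonical_def append_Nil)
qed

section \<open>Soundness of the tree operations and of the reduction\<close>

fun tree_tens :: "tree \<Rightarrow> tens" where
  "tree_tens Leaf = 0"
| "tree_tens (Node l n w c r) = tree_tens l + tsmul (of_int c) (diagram_tens w) + tree_tens r"

lemma insert_term_sound: "tree_tens (insert_term n w c t) = tree_tens t + tsmul (of_int c)
    (diagram_tens w)"
proof (induction n w c t rule: insert_term.induct)
  case (2 n w c l m v d r)
  have "w = v" if "cmp_key (cmp_nat n m) w v = EQ"
    using that by (cases "cmp_nat n m") (auto dest: cmp_diagram_EQ)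
  with 2 show ?case
    by (cases "cmp_key (cmp_nat n m) w v") (simp_all add: algebra_simps)
qed simp

lemma insert_all_sound: "tree_tens (insert_all ps t) \<approx> tree_tens t + lincomb_tens ps"
proof (induction ps t rule: insert_all.induct)
  case (2 c w ts t)
  have "tree_tens (insert_canonical (canonical w) c t) \<approx> tree_tens t + tsmul (of_int c)
      (diagram_tens w)"
  proof (cases "canonical w")
    case None
    then have "diagram_tens w \<approx> 0"
      using canonical_sound[of w] by (simp only: option.case)
    then have "tsmul (of_int c) 0 \<approx> tsmul (of_int c) (diagram_tens w)"
      by (rule keq_smul[OF keq_sym])
    from keq_add[OF keq_refl[of so8 nform level "tree_tens t"] this] show ?thesis
      by (simp only: None insert_canonical.simps tsmul_simps(7) add_0_right)
  next
    case (Some p)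
    obtain sg w' where p: "p = (sg, w')" by (cases p)
    have "diagram_tens w \<approx> tsmul (sign sg) (diagram_tens w')"
      using canonical_sound[of w] by (simp only: Some p option.case prod.case)
    then have "tsmul (of_int c) (tsmul (sign sg) (diagram_tens w')) \<approx> tsmul (of_int c) (diagram_tens
        w)"
      by (rule keq_smul[OF keq_sym])
    moreover have "of_int c * sign sg = of_int (signed sg c)"
      by (cases sg) (simp_all add: sign_def)
    ultimately show ?thesis
      using keq_add[OF keq_refl[of so8 nform level "tree_tens t"]]
      by (simp only: Some p insert_canonical.simps insert_term_sound tsmul_simps(5))
  qed
  from keq_trans[OF 2 keq_add[OF this keq_refl[of so8 nform level "lincomb_tens ts"]]] show ?case
    by (simp only: insert_all.simps lincomb_tens.simps add.assoc)
qed simp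

lemma pop_max_sound:
  "pop_max l n w c r = (v, d, t) \<Longrightarrow> tree_tens t + tsmul (of_int d) (diagram_tens v) = tree_tens (Node
      l n w c r)"
proof (induction l n w c r arbitrary: v d t rule: pop_max.induct)
  case (2 l n w c l' n' w' c' r')
  obtain v' d' t' where *: "pop_max l' n' w' c' r' = (v', d', t')" by (metis prod_cases3)
  from 2(1)[OF *] 2(2) show ?case by (auto simp: * algebra_simps)
qed simp

lemma diagram_tens_vacuum:
  assumes "mode l \<ge> 0" shows "diagram_tens (rev u @ [l]) \<approx> 0"
proof -
  obtain m i b j d where l: "l = L m i b j d" by (cases l)
  have "(\<Sum>r\<in>assignments. term_at r (rev u @ [l])) \<approx> (\<Sum>r\<in>assignments. 0)"
    unfolding term_at_def l eval_diagram_append eval_diagram.simps to_word_append to_word.simps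
    using assms by (intro keq_sum keq_vacuum) (simp_all add: l slot_index_idx to_word_gwords Jm_so8)
  from keq_smul[OF this] show ?thesis by (simp only: diagram_tens_def sum.neutral_const
      tsmul_simps(7))
qed

lemma push_right_sound: "push_right c u w = Some ts \<Longrightarrow> tsmul (of_int c) (diagram_tens (rev u @ w)) \<approx>
    lincomb_tens ts"
proof (induction c u w rule: push_right.induct)
  case (2 c u l w)
  show ?case
  proof (cases "mode l < 0")
    case True
    with 2 show ?thesis by simp
  next
    case False
    show ?thesis
    proof (cases w)
      case Nil
      then show ?thesis
        using 2(2) False keq_smul[OF diagram_tens_vacuum[of l u], of "of_int c"] by simp
    next
      case (Cons k v)
      then show ?thesis using 2(2) False swap_terms_sound[of c u l k v] by auto
    qed
  qed
qed simp

lemma sort_modes_sound: "sort_modes c u w = Some ts \<Longrightarrow> tsmul (of_int c) (diagram_tens (rev u @ w)) \<approx>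
    lincomb_tens ts"
  by (induction c u w rule: sort_modes.induct) (auto split: if_splits intro: swap_terms_sound)

lemma try_swap_sound:
  assumes "try_swap (canonical (rev_append u (l # k # w))) (rev u @ k # l # w) c u k l w = Some ts"
  shows "tsmul (of_int c) (diagram_tens (rev u @ k # l # w)) \<approx> lincomb_tens ts"
proof (cases "canonical (rev u @ l # k # w)")
  case None
  with assms show ?thesis by simp
next
  case (Some p)
  obtain sg z where p: "p = (sg, z)" by (cases p)
  show ?thesis
  proof (cases "cmp_diagram z (rev u @ k # l # w)")
    case EQ
    then have z: "z = rev u @ k # l # w" by (rule cmp_diagram_EQ)
    have c: "\<not> sg" "even c" "ts = bracket (c div 2) u k l w"
      using assms EQ by (cases sg; cases "even c"; simp add: Some p)+
    have "diagram_tens (rev u @ l # k # w) \<approx> - diagram_tens (rev u @ k # l # w)"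
      using canonical_sound[of "rev u @ l # k # w"] c(1) by (simp add: Some p z sign_def)
    then have "tsmul (of_int (c div 2)) (diagram_tens (rev u @ k # l # w) - - diagram_tens (rev u @
        k # l # w)) \<approx>
        tsmul (of_int (c div 2)) (diagram_tens (rev u @ k # l # w) - diagram_tens (rev u @ l # k #
            w))"
      by (intro keq_smul keq_diff keq_refl, rule keq_sym)
    moreover have "tsmul (of_int (c div 2)) (diagram_tens (rev u @ k # l # w) - - diagram_tens (rev
        u @ k # l # w)) =
        tsmul (of_int c) (diagram_tens (rev u @ k # l # w))"
    proof -
      have c2: "of_int (c div 2) + of_int (c div 2) = (of_int c :: complex)"
        using c(2) by (metis dvd_mult_div_cancel mult_2 of_int_add)
      have "tsmul (of_int (c div 2)) (diagram_tens (rev u @ k # l # w) - - diagram_tens (rev u @ k #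
          l # w)) =
          tsmul (of_int (c div 2) + of_int (c div 2)) (diagram_tens (rev u @ k # l # w))"
        by (simp only: diff_minus_eq_add tsmul_simps)
      then show ?thesis by (simp only: c2)
    qed
    ultimately show ?thesis
      using bracket_sound[of "c div 2" u k l w] by (auto simp only: c(3) elim: keq_trans)
  qed (use assms swap_terms_sound[of c u k l w] in \<open>simp_all add: Some p\<close>)
qed

lemma try_swaps_sound:
  "try_swaps c z u w = Some ts \<Longrightarrow> z = rev u @ w \<Longrightarrow> tsmul (of_int c) (diagram_tens z) \<approx> lincomb_tens
      ts"
  by (induction c z u w rule: try_swaps.induct)
    (auto split: if_splits option.splits intro: try_swap_sound)

lemma rewrite_step_sound: "rewrite_step c w = Some ts \<Longrightarrow> tsmul (of_int c) (diagram_tens w) \<approx>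
    lincomb_tens ts"
  using push_right_sound[of c "[]" w] sort_modes_sound[of c "[]" w] try_swaps_sound[of c w "[]" w]
  unfolding rewrite_step_def by (cases "push_right c [] w"; cases "sort_modes c [] w") auto

lemma reduce1_sound: "tree_tens (reduce1 t) \<approx> tree_tens t"
proof (cases t)
  case (Node l n w c r)
  obtain v d t' where pop: "pop_max l n w c r = (v, d, t')" by (metis prod_cases3)
  have t: "tree_tens t' + tsmul (of_int d) (diagram_tens v) = tree_tens t"
    using pop_max_sound[OF pop] by (simp only: Node)
  show ?thesis
  proof (cases "rewrite_step d v")
    case (Some ts)
    have "tree_tens (insert_all ts t') \<approx> tree_tens t' + tsmul (of_int d) (diagram_tens v)"
      by (rule keq_trans[OF insert_all_sound keq_add[OF keq_refl keq_sym[OF rewrite_step_sound[OF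
          Some]]]])
    with t have "tree_tens (insert_all ts t') \<approx> tree_tens t" by (simp only:)
    with t show ?thesis by (cases "d = 0") (simp_all add: Node pop Some)
  qed (use t in \<open>cases "d = 0"; simp add: Node pop\<close>)
qed simp

lemma reduce_sound: "tree_tens (reduce n t) \<approx> tree_tens t"
proof (induction n t rule: reduce.induct)
  case (2 n t)
  from keq_trans[OF 2(2) 2(1)] show ?case by (simp only: reduce.simps)
qed (simp only: reduce.simps reduce1_sound)

lemma reduce_Leaf:
  assumes "reduce n (insert_all ps Leaf) = Leaf" shows "lincomb_tens ps \<approx> 0"
proof -
  have "tree_tens (reduce n (insert_all ps Leaf)) \<approx> tree_tens Leaf + lincomb_tens ps"
    by (rule keq_trans[OF reduce_sound insert_all_sound])
  then have "0 \<approx> lincomb_tens ps" by (simp add: assms)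
  then show ?thesis by (rule keq_sym)
qed

section \<open>The singular vector\<close>

fun scale :: "int \<Rightarrow> (int \<times> diagram) option \<Rightarrow> (int \<times> diagram) option" where
  "scale k None = None" | "scale k (Some (x, w)) = Some (k * x, w)"

text \<open>The first slot of the head letter carries the dual of the row index passed from matrix to
  matrix.\<close>

fun pairing :: "nat \<Rightarrow> (int \<times> diagram) option \<Rightarrow> int" where
  "pairing n None = 0"
| "pairing n (Some (c, [])) = 0"
| "pairing 0 (Some (c, L m i b j d # w)) = (case contract i b 0 True [] of None \<Rightarrow> 0 | Some (x, w') \<Rightarrow>
    c * x)"
| "pairing (Suc n) (Some (c, [l])) = 0"
| "pairing (Suc n) (Some (c, L m' i b i' b' # L m j d k e # w)) =
     pairing n (scale (3 * c) (contract j d i b (L 0 k e 0 False # w)))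
     + pairing n (scale (-3 * c) (contract k e i b (L 0 j d 0 False # w)))"

text \<open>On negative modes this is \<open>phi\<close>: the state \<open>t\<close> is 9 - i for
  the current row i. \<open>Jm a b\<close> has entries 1 at (a, 9 - b) and -1 at (b, 9 - a), so the
  next state is b or a. At the end \<open>metric t 8\<close> tests i = 8, the starting basis vector.
  The index 1 fills the second slot of the carrier letter.\<close>

fun psi :: "index_word \<Rightarrow> complex" where
  "psi [] = 0"
| "psi [(m, t, z)] = metric t 8"
| "psi ((m, t, z) # (m', a, b) # w) =
     metric a t * psi ((0, b, 1) # w) - metric b t * psi ((0, a, 1) # w)"

text \<open>Each matrix accounts for a factor 24, of which 8 is absorbed by its contraction and 3
  appears in \<open>pairing\<close>. The contraction that ends the product gives the extra 8, and
  the constant 1 left over sums to the number of assignments.\<close>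

lemma pairing_sound:
  "length w = Suc n \<Longrightarrow>
    of_int (pairing n (Some (c, w))) * of_nat (card assignments) =
      of_int c * 8 * 24 ^ n * (\<Sum>r\<in>assignments. psi (eval_diagram r w))"
proof (induction n arbitrary: c w)
  case 0
  then obtain m i b j d where w: "w = [L m i b j d]"
    by (metis length_0_conv length_Suc_conv letter_shape.exhaust)
  have "slot_index r 0 True = 8" if "r \<in> assignments" for r
    using assignments_external[OF that, of 0] by (simp add: slot_index_def internal_iff)
  then have "(\<Sum>r\<in>assignments. psi (eval_diagram r w)) = (\<Sum>r\<in>assignments. metric (slot_index r i b)
      (slot_index r 0 True) * 1)"
    by (simp add: w)
  with contract_sound[of i b 0 True "\<lambda>_. 1" "[]"] show ?case
    by (auto simp: w mult.assoc[symmetric] split: option.splits)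
next
  case (Suc n)
  then obtain m i b i' b' l w' where w: "w = L m i b i' b' # l # w'" and size_of: "length w' = n"
    by (metis length_Suc_conv letter_shape.exhaust)
  obtain m' j d k e where l: "l = L m' j d k e" by (cases l)
  have zero: "slot_index r 0 False = 1" if "r \<in> assignments" for r
    using assignments_external[OF that, of 0] by (simp add: slot_index_def internal_iff)
  have branch: "of_int (pairing n (scale c (contract j d i b (L 0 k e 0 False # w')))) * of_nat
      (card assignments) =
      of_int c * 24 ^ n * 8 * (8 * (\<Sum>r\<in>assignments. metric (slot_index r j d) (slot_index r i b) *
          psi ((0, slot_index r k e, 1) # eval_diagram r w')))"
    for c j d k e
  proof -
    have *: "8 * (\<Sum>r\<in>assignments. metric (slot_index r j d) (slot_index r i b) * psi ((0, slot_index
        r k e, 1) # eval_diagram r w')) =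
      (case contract j d i b (L 0 k e 0 False # w') of None \<Rightarrow> 0 | Some (x, w') \<Rightarrow> of_int x *
          (\<Sum>r\<in>assignments. psi (eval_diagram r w')))"
      unfolding contract_sound[symmetric] by (simp add: zero)
    show ?thesis
    proof (cases "contract j d i b (L 0 k e 0 False # w')")
      case None
      with * show ?thesis by simp
    next
      case (Some p)
      obtain x v where p: "p = (x, v)" by (cases p)
      have "length v = Suc n" using contract_length[of j d i b _ x v] Some p size_of by simp
      from Suc.IH[OF this, of "c * x"] show ?thesis
        unfolding * by (simp add: Some p)
    qed
  qed
  show ?case
    unfolding w l pairing.simps of_int_add distrib_right branch
    by (simp add: sum_subtractf algebra_simps)
qed

lemma psi_phi:
  "\<forall>(m, a, b)\<in>set w. m < 0 \<and> a \<in> idx \<and> b \<in> idx \<Longrightarrow> n = - sum_list (map fst w) \<Longrightarrow> i \<in> idx \<Longrightarrow>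
    psi ((m, 9 - i, z) # w) = phi k (to_word w) n i"
proof (induction w arbitrary: n i m z)
  case Nil
  then show ?case by (auto simp: metric_def idx_def)
next
  case (Cons x w)
  obtain q a b where x: "x = (q, a, b)" by (cases x)
  have ab: "q < 0" "a \<in> idx" "b \<in> idx" using Cons.prems by (auto simp: x)
  have IH: "psi ((0, c, Suc 0) # w) = phi k (to_word w) (n + q) (9 - c)" if "c \<in> idx" for c
  proof -
    have "9 - c \<in> idx" "9 - (9 - c) = c" using that by (auto simp: idx_def)
    then show ?thesis using Cons.IH[of "n + q" "9 - c" 0 "Suc 0"] Cons.prems by (simp add: x)
  qed
  have entry: "(\<Sum>l\<in>idx. Jm a b i l * f l) = of_bool (a = i) * f (9 - b) - of_bool (b = i) * f (9 -
      a)"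
    for f :: "nat \<Rightarrow> complex"
  proof -
    have "(\<Sum>l\<in>idx. Jm a b i l * f l) =
      (\<Sum>l\<in>idx. if l = 9 - b then of_bool (a = i) * f (9 - b) else 0)
      - (\<Sum>l\<in>idx. if l = 9 - a then of_bool (b = i) * f (9 - a) else 0)"
      unfolding sum_subtractf[symmetric] by (intro sum.cong) (auto simp: Jm_def Eu_def)
    then show ?thesis using dual_idx[OF ab(2)] dual_idx[OF ab(3)] by (simp add: idx_def)
  qed
  have "metric c (9 - i) = of_bool (c = i)" if "c \<in> idx" for c
    using that Cons.prems(3) by (auto simp: metric_def idx_def)
  then show ?case
    using ab by (simp add: x IH entry)
qed

definition weight :: "diagram \<Rightarrow> int" where "weight w = sum_list (map mode w)"

lemma fst_eval_diagram: "map fst (eval_diagram r w) = map mode w"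
  by (induction r w rule: eval_diagram.induct) simp_all

lemma wdeg_eval_diagram: "wdeg (to_word (eval_diagram r w)) = - weight w"
proof -
  have "map snd (to_word x) = map fst x" for x by (induction x rule: to_word.induct) simp_all
  then show ?thesis by (simp add: wdeg_def weight_def fst_eval_diagram)
qed

lemma eval_diagram_neg:
  assumes "r \<in> assignments" "\<forall>l\<in>set w. mode l < 0"
  shows "\<forall>(m, a, b)\<in>set (eval_diagram r w). m < 0 \<and> a \<in> idx \<and> b \<in> idx"
  using assms by (induction r w rule: eval_diagram.induct) (simp_all add: slot_index_idx)

lemma fsupp_sum: "(\<And>x. x \<in> S \<Longrightarrow> fsupp (f x)) \<Longrightarrow> fsupp (\<Sum>x\<in>S. f x)"
  by (induction S rule: infinite_finite_induct) simp_all

lemma phi_ext_sum: "(\<And>x. x \<in> S \<Longrightarrow> fsupp (f x)) \<Longrightarrow> phi_ext k (\<Sum>x\<in>S. f x) = (\<Sum>x\<in>S. phi_ext k (f x))"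
  by (induction S rule: infinite_finite_induct) (simp_all add: fsupp_sum)

lemma fsupp_diagram_tens: "fsupp (diagram_tens w)"
  unfolding diagram_tens_def term_at_def by (intro fsupp_simps fsupp_sum)

lemma fsupp_sem: "fsupp (lincomb_tens ps)"
  by (induction ps rule: lincomb_tens.induct) (simp_all add: fsupp_diagram_tens)

text \<open>The carrier letter in front has first index 8 = 9 - 1, so the product is read from row
  1.\<close>

lemma phi_ext_diagram_tens:
  assumes "\<forall>l\<in>set w. mode l < 0" "weight w = - 6"
  shows "of_int (pairing (length w) (Some (c, L 0 0 True 0 False # w))) * of_nat (card assignments)
      =
    8 * phi_ext k (tsmul (of_int c) (diagram_tens w))"
proof -
  have "psi (eval_diagram r (L 0 0 True 0 False # w)) = phi k (to_word (eval_diagram r w)) 6 1" if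
      "r \<in> assignments" for r
  proof -
    have "slot_index r 0 True = 9 - 1"
      using assignments_external[OF that, of 0] by (simp add: slot_index_def internal_iff)
    then show ?thesis
      using psi_phi[OF eval_diagram_neg[OF that assms(1)], of 6 1 0 _ k] assms(2)
      by (simp add: fst_eval_diagram weight_def idx_def)
  qed
  then have "phi_ext k (diagram_tens w) = 24 ^ length w * (\<Sum>r\<in>assignments. psi (eval_diagram r (L 0
      0 True 0 False # w)))"
    unfolding diagram_tens_def term_at_def by (simp add: fsupp_sum phi_ext_sum del:
        eval_diagram.simps)
  then show ?thesis
    by (subst pairing_sound) (simp_all add: fsupp_diagram_tens)
qed

definition admissible :: "diagram \<Rightarrow> bool" where
  "admissible w \<longleftrightarrow> (\<forall>l\<in>set w. mode l < 0) \<and> weight w = - 6"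

fun pairings :: "lincomb \<Rightarrow> int" where
  "pairings [] = 0"
| "pairings ((c, w) # ps) = pairing (length w) (Some (c, L 0 0 True 0 False # w)) + pairings ps"

lemma pairings_sound:
  "list_all (admissible \<circ> snd) ps \<Longrightarrow> of_int (pairings ps) * of_nat (card assignments) = 8 * phi_ext k
      (lincomb_tens ps)"
  by (induction ps rule: pairings.induct)
    (simp_all add: admissible_def phi_ext_diagram_tens[where k = k] fsupp_diagram_tens fsupp_sem
        distrib_left distrib_right)

lemma lincomb_tens_support:
  "lincomb_tens ps w \<noteq> 0 \<Longrightarrow> \<exists>(c, x)\<in>set ps. \<exists>r\<in>assignments. w = to_word (eval_diagram r x)"
proof (induction ps rule: lincomb_tens.induct)
  case (2 c x ps)
  show ?case
  proof (cases "diagram_tens x w = 0")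
    case False
    then have "\<exists>r\<in>assignments. term_at r x w \<noteq> 0"
      by (auto simp: diagram_tens_def tsmul_def sum_tens_apply dest:
          sum.not_neutral_contains_not_neutral)
    then show ?thesis by (auto simp: term_at_def mono_def split: if_splits)
  next
    case True
    with 2 show ?thesis by (auto simp: tsmul_def plus_fun_apply)
  qed
qed (simp add: zero_fun_apply)

section \<open>Applying a mode to a combination of diagrams\<close>

definition prefix :: "letter_shape \<Rightarrow> lincomb \<Rightarrow> lincomb" where
  "prefix l = map (\<lambda>(c, w). (c, l # w))"

lemma lincomb_tens_prefix:
  assumes "\<And>r. r \<in> assignments \<Longrightarrow> slot_index r i b = p" "\<And>r. r \<in> assignments \<Longrightarrow> slot_index r j d = q"
  shows "lincomb_tens (prefix (L n i b j d) ps) = tsmul 24 (act (Jm p q) n (lincomb_tens ps))"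
proof (induction ps rule: lincomb_tens.induct)
  case (2 c w ps)
  have "(\<Sum>r\<in>assignments. term_at r (L n i b j d # w)) = lmul [(Jm p q, n)] (\<Sum>r\<in>assignments. term_at
      r w)"
    unfolding lmul_sum by (intro sum.cong) (simp_all add: term_at_def assms)
  then have "diagram_tens (L n i b j d # w) = tsmul 24 (act (Jm p q) n (diagram_tens w))"
    by (simp add: diagram_tens_def act_def)
  with 2 show ?case by (simp add: prefix_def act_def mult.commute)
qed (simp add: prefix_def act_def)

lemma lincomb_tens_append: "lincomb_tens (ps @ qs) = lincomb_tens ps + lincomb_tens qs"
  by (induction ps rule: lincomb_tens.induct) (simp_all add: add.assoc)

lemma lincomb_tens_scale: "lincomb_tens (map (\<lambda>(c, w). (x * c, w)) ps) = tsmul (of_int x)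
    (lincomb_tens ps)"
  by (induction ps rule: lincomb_tens.induct) simp_all

lemma slot_index_external: "r \<in> assignments \<Longrightarrow> i < 4 \<Longrightarrow> slot_index r i b = (if b then 8 - i else i +
    1)"
  using assignments_external[of r i] by (auto simp: slot_index_def internal_iff)

lemma annihilates:
  assumes "reduce k (insert_all (prefix (L n i b j d) ps) Leaf) = Leaf" "i < 4" "j < 4"
  shows "act (Jm (if b then 8 - i else i + 1) (if d then 8 - j else j + 1)) n (lincomb_tens ps) \<approx> 0"
proof -
  have "tsmul 24 (act (Jm (if b then 8 - i else i + 1) (if d then 8 - j else j + 1)) n (lincomb_tens
      ps)) \<approx> 0"
    using reduce_Leaf[OF assms(1)] lincomb_tens_prefix[of i b _ j d _ n ps] assms(2,3) by (simp add:
        slot_index_external)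
  from keq_smul[OF this, of "1/24"] show ?thesis by simp
qed

lemma card_assignments: "card assignments \<noteq> 0"
proof -
  have "(\<lambda>i. if i < 4 then i + 1 else 1) \<in> assignments"
    by (auto simp: assignments_def label_range_def idx_def internal_iff)
  then show ?thesis using finite_assignments by auto
qed

text \<open>The coefficient of a diagram with \<open>l\<close> letters is \<open>139968 / 3 ^ l\<close> times the one in the
  kernel vector normalised to 1 at the product of \<open>[1, 1]\<close> and the trace \<open>[1, 1, 1, 1]\<close>.\<close>

definition singular_vector :: lincomb where
  "singular_vector = [(27734016, mk_diagram [5, 1] []),
    (-80126976, mk_diagram [4, 2] []),
    (-8340480, mk_diagram [4, 1, 1] []),
    (-44197888, mk_diagram [3, 3] []),
    (-8244224, mk_diagram [3, 2, 1] []),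
    (1922048, mk_diagram [3, 1, 2] []),
    (416768, mk_diagram [3, 1, 1, 1] []),
    (-7188480, mk_diagram [2, 3, 1] []),
    (396288, mk_diagram [2, 2, 1, 1] []),
    (557056, mk_diagram [2, 1, 2, 1] []),
    (332800, mk_diagram [2, 1, 1, 2] []),
    (-16384, mk_diagram [2, 1, 1, 1, 1] []),
    (304128, mk_diagram [1, 3, 1, 1] []),
    (203776, mk_diagram [1, 2, 2, 1] []),
    (-8192, mk_diagram [1, 2, 1, 1, 1] []),
    (-1024, mk_diagram [1, 1, 1, 1, 1, 1] []),
    (-6144, mk_diagram [3, 1] [[1, 1]]),
    (-11136, mk_diagram [2, 2] [[1, 1]]),
    (3072, mk_diagram [2, 1, 1] [[1, 1]]),
    (384, mk_diagram [1, 1, 1, 1] [[1, 1]]),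
    (-150528, mk_diagram [2, 1] [[2, 1]]),
    (-72, mk_diagram [1, 1] [[1, 1], [1, 1]]),
    (-104448, mk_diagram [1, 1] [[3, 1]]),
    (-46272, mk_diagram [1, 1] [[2, 2]]),
    (192, mk_diagram [1, 1] [[1, 1, 1, 1]])]"

section \<open>Singularity, weight and nonvanishing by evaluation\<close>

lemma singular_f:
  "reduce 11 (insert_all (prefix (L 1 1 True 0 True) singular_vector) Leaf) = Leaf"
  by code_simp

text \<open>In order: the root vectors for epsilon_i - epsilon_(i+1) with i = 1, 2, 3, the one for
  epsilon_3 + epsilon_4, and the Cartan elements with numbers 2, 3, 4.\<close>

lemma singular_zero_modes:
  "list_all (\<lambda>l. reduce 9 (insert_all (prefix l singular_vector) Leaf) = Leaf)
    [L 0 0 False 1 True, L 0 1 False 2 True, L 0 2 False 3 True, L 0 2 False 3 False,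
     L 0 1 False 1 True, L 0 2 False 2 True, L 0 3 False 3 True]"
  by code_simp

text \<open>The prefixed letter brings the factor 24, so the eigenvalue 2 of the first Cartan
  element shows up as 48.\<close>

lemma singular_weight:
  "reduce 9 (insert_all (prefix (L 0 0 False 0 True) singular_vector
    @ map (\<lambda>(c, w). (- 48 * c, w)) singular_vector) Leaf) = Leaf"
  by code_simp

lemma singular_admissible: "list_all (admissible \<circ> snd) singular_vector"
  unfolding admissible_def weight_def by code_simp

text \<open>Up to the nonzero factor 8 / \<open>card assignments\<close> this is the value of the
  functional on the vector.\<close>

lemma singular_pairings: "pairings singular_vector = - 9409720320"
  by code_simp

theorem theorem3p1:
  shows "\<exists>v. tadm so8 v
     \<and> \<not> vkeq so8 nform (-14/3) v (\<lambda>w. 0)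
     \<and> (\<forall>w. v w \<noteq> 0 \<longrightarrow> wdeg w = 6)
     \<and> (\<forall>i\<in>{1..4::nat}. vkeq so8 nform (-14/3) (act (Hc i) 0 v)
                                       (tsmul (if i = 1 then 2 else 0) v))
     \<and> (\<forall>i\<in>{1..3::nat}. vkeq so8 nform (-14/3) (act (e_minus i (i + 1)) 0 v) (\<lambda>w. 0))
     \<and> vkeq so8 nform (-14/3) (act (e_plus 3 4) 0 v) (\<lambda>w. 0)
     \<and> vkeq so8 nform (-14/3) (act (f_plus 1 2) 1 v) (\<lambda>w. 0)"
proof -
  let ?v = "lincomb_tens singular_vector"
  note zero_modes = annihilates[OF singular_zero_modes[unfolded list_all_iff, rule_format]]
  have support: "\<exists>x r. r \<in> assignments \<and> admissible x \<and> w = to_word (eval_diagram r x)" if "?v w \<noteq>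
      0" for w
    using lincomb_tens_support[OF that] singular_admissible by (fastforce simp: list_all_iff)
  have "tadm so8 ?v"
    using fsupp_sem[of singular_vector] support to_word_gwords by (auto simp: tadm_def fsupp_def)
  moreover have "\<not> ?v \<approx> 0"
  proof
    assume "?v \<approx> 0"
    then have "phi_ext level ?v = 0" by (rule phi_ext_keq)
    with pairings_sound[OF singular_admissible, of level] show False
      by (simp add: singular_pairings card_assignments)
  qed
  moreover have "wdeg w = 6" if "?v w \<noteq> 0" for w
    using support[OF that] by (auto simp: wdeg_eval_diagram admissible_def)
  moreover have "act (Hc i) 0 ?v \<approx> tsmul (if i = 1 then 2 else 0) ?v" if "i \<in> {1..4}" for i
  proof -
    from that consider "i = 1" | "i = 2" | "i = 3" | "i = 4" by fastforce
    then show ?thesis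
    proof cases
      case 1
      have "tsmul 24 (act (Hc 1) 0 ?v) + tsmul (- 48) ?v \<approx> 0"
        using reduce_Leaf[OF singular_weight] lincomb_tens_prefix[of 0 False 1 0 True 8 0
            singular_vector]
        by (simp add: lincomb_tens_append lincomb_tens_scale[of "- 48", simplified]
            slot_index_external Hc_eq idx_def)
      from keq_add[OF keq_smul[OF this, of "1/24"] keq_refl[of so8 nform level "tsmul 2 ?v"]]
      show ?thesis by (simp add: 1)
    next
      case 2
      then show ?thesis using zero_modes[of 0 1 False 1 True] by (simp add: Hc_eq idx_def
          numeral_2_eq_2)
    next
      case 3
      then show ?thesis using zero_modes[of 0 2 False 2 True] by (simp add: Hc_eq idx_def)
    next
      case 4
      then show ?thesis using zero_modes[of 0 3 False 3 True] by (simp add: Hc_eq idx_def)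
    qed
  qed
  moreover have "act (e_minus i (i + 1)) 0 ?v \<approx> 0" if "i \<in> {1..3}" for i
  proof -
    from that consider "i = 1" | "i = 2" | "i = 3" by fastforce
    then show ?thesis
      using zero_modes[of 0 0 False 1 True] zero_modes[of 0 1 False 2 True] zero_modes[of 0 2 False
          3 True]
      by cases (simp_all add: e_minus_eq idx_def eval_nat_numeral)
  qed
  moreover have "act (e_plus 3 4) 0 ?v \<approx> 0"
    using zero_modes[of 0 2 False 3 False] by (simp add: e_plus_eq)
  moreover have "act (f_plus 1 2) 1 ?v \<approx> 0"
    using annihilates[OF singular_f] by (simp add: f_plus_eq idx_def)
  ultimately show ?thesis
    unfolding level_def zero_fun_def by blast
qed

end
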